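(* Let $K$ be an infinite field, $A=K[X_1,\ldots,X_n]$, $I\subseteq A$ a homogeneous ideal, and $\omega=(\omega_1,\ldots,\omega_n)$ a weight with $\omega_1\geq\cdots\geq\omega_n$. Then there exists a non-empty Zariski open set $U\subseteq\mathrm{GL}_n(K)\subset K^{n^2}$ such that $b\big(\operatorname{in}_\omega(g(I))\big)=\operatorname{in}_\omega(g(I))$ for all $g\in U$ and all $b\in\mathcal B_\omega$.
   Context: A weight is a vector $\omega\in\mathbb R^n$; the weight of a monomial $\mathbf X^{\mathbf a}$ is $\omega\cdot\mathbf a$. For a polynomial $f$, $\operatorname{in}_\omega(f)$ is the sum of the terms of $f$ of maximal weight, and $\operatorname{in}_\omega(J)$ is the ideal generated by all $\operatorname{in}_\omega(f)$, $f\in J$. A matrix $h=(h_{ij})\in\mathrm{GL}_n(K)$ acts on $A$ as the linear change of coordinates $X_j\mapsto\sum_{i=1}^n h_{ij}X_i$, and $h(J)$ denotes the image of an ideal $J$. $\mathcal B_\omega$ is the group of $n\times n$ upper-triangular matrices $M=(m_{ij})$ over $K$ with $m_{ii}=1$ for all $i$ and $m_{ij}=0$ whenever $i\neq j$ and $\omega_i=\omega_j$. *)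

theory Defs
  imports Complex_Main "HOL-Library.Poly_Mapping" "HOL-Combinatorics.Permutations"
begin

text \<open>Multivariate polynomials over a field 'k: finitely supported maps from monomials
  (finitely supported exponent vectors) to coefficients. Variables are indexed from 0.\<close>

type_synonym 'k mpoly = "(nat \<Rightarrow>\<^sub>0 nat) \<Rightarrow>\<^sub>0 'k"

definition Var :: "nat \<Rightarrow> 'k::comm_ring_1 mpoly" where
  "Var i = Poly_Mapping.single (Poly_Mapping.single i 1) 1"

definition Const :: "'k::comm_ring_1 \<Rightarrow> 'k mpoly" where
  "Const c = Poly_Mapping.single 0 c"

definition polyring :: "nat \<Rightarrow> 'k::comm_ring_1 mpoly set" where
  "polyring n = {f. \<forall>m \<in> Poly_Mapping.keys f. Poly_Mapping.keys m \<subseteq> {..<n}}"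

definition is_ideal :: "nat \<Rightarrow> 'k::comm_ring_1 mpoly set \<Rightarrow> bool" where
  "is_ideal n J \<longleftrightarrow> J \<subseteq> polyring n \<and> 0 \<in> J \<and> (\<forall>f\<in>J. \<forall>g\<in>J. f + g \<in> J)
     \<and> (\<forall>a\<in>polyring n. \<forall>f\<in>J. a * f \<in> J)"

definition ideal_gen :: "nat \<Rightarrow> 'k::comm_ring_1 mpoly set \<Rightarrow> 'k mpoly set" where
  "ideal_gen n S = \<Inter>{J. is_ideal n J \<and> S \<subseteq> J}"

definition mdeg :: "(nat \<Rightarrow>\<^sub>0 nat) \<Rightarrow> nat" where
  "mdeg m = (\<Sum>i\<in>Poly_Mapping.keys m. Poly_Mapping.lookup m i)"

definition hcomp :: "nat \<Rightarrow> 'k::comm_ring_1 mpoly \<Rightarrow> 'k mpoly" where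
  "hcomp d f = (\<Sum>m\<in>{m \<in> Poly_Mapping.keys f. mdeg m = d}.
      Poly_Mapping.single m (Poly_Mapping.lookup f m))"

definition homogeneous_ideal :: "nat \<Rightarrow> 'k::comm_ring_1 mpoly set \<Rightarrow> bool" where
  "homogeneous_ideal n I \<longleftrightarrow> is_ideal n I \<and> (\<forall>f\<in>I. \<forall>d. hcomp d f \<in> I)"

definition mweight :: "nat \<Rightarrow> (nat \<Rightarrow> real) \<Rightarrow> (nat \<Rightarrow>\<^sub>0 nat) \<Rightarrow> real" where
  "mweight n \<omega> a = (\<Sum>i<n. \<omega> i * real (Poly_Mapping.lookup a i))"

definition init_form :: "nat \<Rightarrow> (nat \<Rightarrow> real) \<Rightarrow> 'k::comm_ring_1 mpoly \<Rightarrow> 'k mpoly" where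
  "init_form n \<omega> f = (\<Sum>m\<in>{m \<in> Poly_Mapping.keys f.
        mweight n \<omega> m = Max (mweight n \<omega> ` Poly_Mapping.keys f)}.
      Poly_Mapping.single m (Poly_Mapping.lookup f m))"

definition init_ideal :: "nat \<Rightarrow> (nat \<Rightarrow> real) \<Rightarrow> 'k::comm_ring_1 mpoly set \<Rightarrow> 'k mpoly set" where
  "init_ideal n \<omega> J = ideal_gen n (init_form n \<omega> ` J)"

definition subst :: "(nat \<Rightarrow> 'k::comm_ring_1 mpoly) \<Rightarrow> 'k mpoly \<Rightarrow> 'k mpoly" where
  "subst \<sigma> f = (\<Sum>m\<in>Poly_Mapping.keys f. Const (Poly_Mapping.lookup f m) *
      (\<Prod>i\<in>Poly_Mapping.keys m. \<sigma> i ^ Poly_Mapping.lookup m i))"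

definition act :: "nat \<Rightarrow> (nat \<Rightarrow> nat \<Rightarrow> 'k::comm_ring_1) \<Rightarrow> 'k mpoly set \<Rightarrow> 'k mpoly set" where
  "act n h J = subst (\<lambda>j. \<Sum>i<n. Const (h i j) * Var i) ` J"

definition matrices :: "nat \<Rightarrow> (nat \<Rightarrow> nat \<Rightarrow> 'k::zero) set" where
  "matrices n = {h. \<forall>i j. (n \<le> i \<or> n \<le> j) \<longrightarrow> h i j = 0}"

definition mdet :: "nat \<Rightarrow> (nat \<Rightarrow> nat \<Rightarrow> 'k::comm_ring_1) \<Rightarrow> 'k" where
  "mdet n h = (\<Sum>p | p permutes {..<n}. of_int (sign p) * (\<Prod>i<n. h i (p i)))"

definition GL :: "nat \<Rightarrow> (nat \<Rightarrow> nat \<Rightarrow> 'k::field) set" where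
  "GL n = {h \<in> matrices n. mdet n h \<noteq> 0}"

definition peval :: "(nat \<Rightarrow> 'k::comm_ring_1) \<Rightarrow> 'k mpoly \<Rightarrow> 'k" where
  "peval x f = (\<Sum>m\<in>Poly_Mapping.keys f. Poly_Mapping.lookup f m *
      (\<Prod>i\<in>Poly_Mapping.keys m. x i ^ Poly_Mapping.lookup m i))"

definition mat_point :: "nat \<Rightarrow> (nat \<Rightarrow> nat \<Rightarrow> 'k) \<Rightarrow> nat \<Rightarrow> 'k" where
  "mat_point n h k = h (k div n) (k mod n)"

definition zariski_open :: "nat \<Rightarrow> (nat \<Rightarrow> nat \<Rightarrow> 'k::field) set \<Rightarrow> bool" where
  "zariski_open n U \<longleftrightarrow> (\<exists>S \<subseteq> polyring (n * n).
      U = {h \<in> matrices n. \<exists>f\<in>S. peval (mat_point n h) f \<noteq> 0})"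

definition Bw :: "nat \<Rightarrow> (nat \<Rightarrow> real) \<Rightarrow> (nat \<Rightarrow> nat \<Rightarrow> 'k::field) set" where
  "Bw n \<omega> = {M \<in> matrices n. (\<forall>i<n. M i i = 1) \<and> (\<forall>i<n. \<forall>j<n. j < i \<longrightarrow> M i j = 0)
      \<and> (\<forall>i<n. \<forall>j<n. i \<noteq> j \<and> \<omega> i = \<omega> j \<longrightarrow> M i j = 0)}"

end

theory Submission
  imports Defs "Jordan_Normal_Form.Determinant"
begin

text \<open>
  Fix a degree \<open>d\<close>. The dimension of the part of \<open>in\<^sub>\<omega>(g(I))\<^sub>d\<close> of weight greater than \<open>u\<close> is the
  rank of the projection of \<open>g(I)\<^sub>d\<close> to the monomials of weight greater than \<open>u\<close>, which is lower
  semicontinuous in \<open>g\<close>. Let \<open>g\<close> maximize all these ranks, among all matrices, and let \<open>x\<close> be a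
  weight-\<open>u\<close> element of \<open>L = in\<^sub>\<omega>(g(I))\<^sub>d\<close>. Since \<open>b\<close> raises weights, \<open>b x = x + z\<close> with \<open>z\<close> of
  weight greater than \<open>u\<close>. If \<open>z\<close> were not in \<open>b(L\<^sub>>\<^sub>u)\<close>, the projection of \<open>b(L)\<close> would have larger
  rank than that of \<open>g(I)\<^sub>d\<close>; as \<open>L\<close> is a limit of torus translates \<open>t g(I)\<^sub>d\<close>, some matrix \<open>b t g\<close>
  would beat \<open>g\<close>. So \<open>b x = x + b y\<close> with \<open>y\<close> of higher weight in \<open>L\<close>, and both \<open>b(L) \<subseteq> L\<close> and
  \<open>L \<subseteq> b(L)\<close> follow by descending induction on weights. That one open set of matrices
  serves all degrees is seen by refining the weight to a monomial order and applying Dickson's lemma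
  to the generic leading monomials.
\<close>

subsection \<open>Polynomial evaluation\<close>

text \<open>The weights are real and the field is arbitrary, so no one-parameter subgroup t^\<omega>
  is available for the limit. The diagonal torus with n independent parameters replaces it: the
  coefficients of t f are polynomials in the parameters, and their top-weight parts, evaluated at
  (1,...,1), play the role of the limit. A suitable t exists because the field is infinite, but it
  may have zero coordinates, so b t g may be singular. This is why the ranks are maximized among all
  matrices, singular ones included. Invertibility of g enters elsewhere: it makes g(I) closed under
  multiplication by monomials. Ranks alone do not pass from one degree to the next; sets of leading
  monomials do, by multiplication, and the ranks on all final segments of the order determine such a
  set. The refined order need not be a well-order, since weights may be negative, so maxima are only
  taken over finite sets of monomials.\<close>

abbreviation "keys \<equiv> Poly_Mapping.keys"
abbreviation "lookup \<equiv> Poly_Mapping.lookup"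
abbreviation "single \<equiv> Poly_Mapping.single"

lemma sum_single_lookup:
  assumes "finite S" "keys f \<subseteq> S"
  shows "(\<Sum>m\<in>S. single m (lookup f m)) = f"
proof (rule poly_mapping_eqI)
  fix k
  have "lookup (\<Sum>m\<in>S. single m (lookup f m)) k = (\<Sum>m\<in>S. if m = k then lookup f m else 0)"
    by (simp add: lookup_sum lookup_single when_def)
  also have "\<dots> = lookup f k"
    using assms by (auto simp: in_keys_iff)
  finally show "lookup (\<Sum>m\<in>S. single m (lookup f m)) k = lookup f k" .
qed

definition mon :: "(nat \<Rightarrow> 'a::comm_monoid_mult) \<Rightarrow> (nat \<Rightarrow>\<^sub>0 nat) \<Rightarrow> 'a" where
  "mon x m = (\<Prod>i\<in>keys m. x i ^ lookup m i)"

lemma mon_superset: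
  assumes "finite S" "keys m \<subseteq> S"
  shows "mon x m = (\<Prod>i\<in>S. x i ^ lookup m i)"
  unfolding mon_def using assms
  by (intro prod.mono_neutral_left) (auto simp: in_keys_iff)

lemma mon_add: "mon x (a + b) = mon x a * mon x b"
proof -
  let ?S = "keys a \<union> keys b"
  have "keys (a + b) \<subseteq> ?S" by (rule keys_add)
  then show ?thesis
    by (simp add: mon_superset[of ?S] lookup_add power_add prod.distrib)
qed

lemma mon_0 [simp]: "mon x 0 = 1"
  by (simp add: mon_def)

lemma mon_single: "mon x (single i k) = x i ^ k"
  by (simp add: mon_def)

text \<open>Substitution and evaluation obey the same laws: with \<open>\<phi>\<close> =
  \<open>Const\<close> the target is the polynomial ring, with \<open>\<phi>\<close> the identity it
  is the coefficient ring. Both are interpreted below.\<close>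

locale evaluation =
  fixes \<phi> :: "'k::comm_ring_1 \<Rightarrow> 'a::comm_ring_1"
    and E :: "(nat \<Rightarrow> 'a) \<Rightarrow> 'k mpoly \<Rightarrow> 'a"
  assumes \<phi>_add: "\<phi> (a + b) = \<phi> a + \<phi> b"
    and \<phi>_mult: "\<phi> (a * b) = \<phi> a * \<phi> b"
    and \<phi>_one: "\<phi> 1 = 1"
    and E_def: "E x f = (\<Sum>m\<in>keys f. \<phi> (lookup f m) * mon x m)"
begin

lemma \<phi>_0: "\<phi> 0 = 0"
  using \<phi>_add[of 0 0] by simp

lemma superset:
  assumes "finite S" "keys f \<subseteq> S"
  shows "E x f = (\<Sum>m\<in>S. \<phi> (lookup f m) * mon x m)"
  unfolding E_def using assms
  by (intro sum.mono_neutral_left) (auto simp: in_keys_iff \<phi>_0)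

lemma zero [simp]: "E x 0 = 0"
  by (simp add: E_def)

lemma add: "E x (f + g) = E x f + E x g"
proof -
  let ?S = "keys f \<union> keys g"
  have "keys (f + g) \<subseteq> ?S" by (rule keys_add)
  then show ?thesis
    by (simp add: superset[of ?S] lookup_add \<phi>_add sum.distrib algebra_simps)
qed

lemma sum: "E x (\<Sum>i\<in>S. f i) = (\<Sum>i\<in>S. E x (f i))"
  by (induction S rule: infinite_finite_induct) (auto simp: add)

lemma single: "E x (single m c) = \<phi> c * mon x m"
  by (simp add: E_def \<phi>_0)

lemma mult: "E x (f * g) = E x f * E x g"
proof -
  have "f * g = (\<Sum>a\<in>keys f. single a (lookup f a)) * (\<Sum>b\<in>keys g. single b (lookup g b))"
    by (simp add: sum_single_lookup)
  also have "\<dots> = (\<Sum>a\<in>keys f. \<Sum>b\<in>keys g. single (a + b) (lookup f a * lookup g b))"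
    by (simp add: sum_product mult_single)
  finally have "E x (f * g) = (\<Sum>a\<in>keys f. \<Sum>b\<in>keys g. \<phi> (lookup f a * lookup g b) * mon x (a + b))"
    by (simp add: sum single)
  then show ?thesis
    by (simp add: sum_product E_def mon_add \<phi>_mult ac_simps)
qed

lemma one [simp]: "E x 1 = 1"
  using single[of x 0 1] by (simp add: \<phi>_one)

lemma power: "E x (f ^ k) = E x f ^ k"
  by (induction k) (auto simp: mult)

lemma prod: "E x (\<Prod>i\<in>S. f i) = (\<Prod>i\<in>S. E x (f i))"
  by (induction S rule: infinite_finite_induct) (auto simp: mult)

lemma Const: "E x (Const c) = \<phi> c"
  by (simp add: Const_def single)

lemma Var: "E x (Var i) = x i"
  by (simp add: Var_def single mon_single \<phi>_one)

lemma minus: "E x (- f) = - E x f"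
  using add[of x f "- f"] by (simp add: add_eq_0_iff)

lemma diff: "E x (f - g) = E x f - E x g"
  using add[of x f "- g"] by (simp add: minus)

end

lemma Const_add: "Const (a + b) = Const a + Const b"
  by (simp add: Const_def single_add)

lemma Const_mult: "Const (a * b) = Const a * Const b"
  by (simp add: Const_def mult_single)

lemma Const_0 [simp]: "Const 0 = 0"
  by (simp add: Const_def)

lemma Const_1 [simp]: "Const 1 = 1"
  by (simp add: Const_def)

lemma Const_sum: "Const (\<Sum>i\<in>S. f i) = (\<Sum>i\<in>S. Const (f i))"
  by (induction S rule: infinite_finite_induct) (auto simp: Const_add)

lemma Const_mult_single: "Const c * single m d = single m (c * d)"
  by (simp add: Const_def mult_single)

lemma lookup_Const_mult [simp]: "lookup (Const c * f) m = c * lookup f m"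
proof -
  have "Const c * f = Const c * (\<Sum>a\<in>keys f. single a (lookup f a))"
    by (simp add: sum_single_lookup)
  also have "\<dots> = (\<Sum>a\<in>keys f. single a (c * lookup f a))"
    by (simp add: sum_distrib_left Const_mult_single)
  finally show ?thesis
    by (auto simp: lookup_sum lookup_single when_def in_keys_iff)
qed

interpretation subst: evaluation Const subst
  by unfold_locales (auto simp: Const_add Const_mult subst_def mon_def)

interpretation peval: evaluation "\<lambda>c. c" peval
  by unfold_locales (auto simp: peval_def mon_def)

lemma mon_Var: "mon Var m = single m 1"
proof -
  have *: "(Var i :: 'a mpoly) ^ k = single (single i k) 1" for i k
    by (induction k) (auto simp: Var_def mult_single simp flip: single_add)
  have "mon Var m = (\<Prod>i\<in>keys m. single (single i (lookup m i)) (1::'a))"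
    by (simp add: mon_def *)
  also have "\<dots> = single (\<Sum>i\<in>keys m. single i (lookup m i)) 1"
    by (induction rule: finite_induct[OF finite_keys[of m]]) (auto simp: mult_single)
  finally show ?thesis by (simp add: sum_single_lookup)
qed

lemma subst_Var: "subst Var f = f"
  by (simp add: subst.E_def mon_Var Const_mult_single sum_single_lookup)

lemma subst_subst: "subst \<sigma> (subst \<tau> f) = subst (\<lambda>i. subst \<sigma> (\<tau> i)) f"
  by (simp add: subst.E_def[of \<tau>] subst.E_def[of _ f] subst.sum subst.mult subst.Const mon_def
      subst.prod subst.power)

lemma subst_cong_keys:
  assumes "\<And>m i. m \<in> keys f \<Longrightarrow> i \<in> keys m \<Longrightarrow> \<sigma> i = \<tau> i"
  shows "subst \<sigma> f = subst \<tau> f"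
  unfolding subst_def using assms by (auto intro!: sum.cong prod.cong)

lemma polyring_keys: "f \<in> polyring n \<longleftrightarrow> (\<forall>m\<in>keys f. keys m \<subseteq> {..<n})"
  by (simp add: polyring_def)

lemma polyring_0 [simp]: "0 \<in> polyring n"
  by (simp add: polyring_def)

lemma polyring_add: "f \<in> polyring n \<Longrightarrow> g \<in> polyring n \<Longrightarrow> f + g \<in> polyring n"
  using keys_add[of f g] unfolding polyring_def by blast

lemma polyring_single: "keys m \<subseteq> {..<n} \<Longrightarrow> single m c \<in> polyring n"
  by (simp add: polyring_def)

lemma polyring_sum: "(\<And>i. i \<in> S \<Longrightarrow> f i \<in> polyring n) \<Longrightarrow> (\<Sum>i\<in>S. f i) \<in> polyring n"
  by (induction S rule: infinite_finite_induct) (simp_all add: polyring_add)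

lemma polyring_mult:
  assumes "f \<in> polyring n" "g \<in> polyring n"
  shows "f * g \<in> polyring n"
  unfolding polyring_keys
proof
  fix m assume "m \<in> keys (f * g)"
  then obtain a b where ab: "m = a + b" "a \<in> keys f" "b \<in> keys g"
    using keys_mult[of f g] by blast
  then have "keys a \<subseteq> {..<n}" "keys b \<subseteq> {..<n}"
    using assms unfolding polyring_keys by blast+
  then show "keys m \<subseteq> {..<n}"
    unfolding ab using keys_add[of a b] by (meson Un_least order_trans)
qed

lemma polyring_Const [simp]: "Const c \<in> polyring n"
  by (auto simp: Const_def intro: polyring_single)

lemma polyring_1 [simp]: "1 \<in> polyring n"
  using polyring_Const[of 1] by simp

lemma polyring_Var: "i < n \<Longrightarrow> Var i \<in> polyring n"
  by (auto simp: Var_def intro!: polyring_single)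

lemma polyring_minus: "f \<in> polyring n \<Longrightarrow> - f \<in> polyring n"
  by (simp add: polyring_def in_keys_iff)

lemma polyring_diff: "f \<in> polyring n \<Longrightarrow> g \<in> polyring n \<Longrightarrow> f - g \<in> polyring n"
  using polyring_add[of f n "- g"] by (simp add: polyring_minus)

lemma polyring_prod: "(\<And>i. i \<in> S \<Longrightarrow> f i \<in> polyring n) \<Longrightarrow> (\<Prod>i\<in>S. f i) \<in> polyring n"
  by (induction S rule: infinite_finite_induct) (simp_all add: polyring_mult)

lemma polyring_power: "f \<in> polyring n \<Longrightarrow> f ^ k \<in> polyring n"
  by (induction k) (simp_all add: polyring_mult)

subsection \<open>Linear independence under specialization\<close>

text \<open>Independence of the rows \<open>A i\<close> restricted to the columns \<open>T\<close>.
  The rows form an indexed family, so a repeated row counts as a dependence; when \<open>A i\<close>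
  is the coefficient function of a polynomial, \<open>T\<close> selects a projection to
  monomials.\<close>

definition indep_on :: "'m set \<Rightarrow> 'i set \<Rightarrow> ('i \<Rightarrow> 'm \<Rightarrow> 'k::field) \<Rightarrow> bool" where
  "indep_on T S A \<longleftrightarrow> (\<forall>c. (\<forall>m\<in>T. (\<Sum>i\<in>S. c i * A i m) = 0) \<longrightarrow> (\<forall>i\<in>S. c i = 0))"

text \<open>One step of Gauss elimination with pivot \<open>A j s\<close>, written without division:
  entries that are polynomials in a parameter stay polynomials, as the openness argument
  requires.\<close>

lemma indep_on_eliminate:
  assumes S: "finite S" "j \<notin> S" and s: "s \<in> T" "A j s \<noteq> 0"
  shows "indep_on T (insert j S) A \<longleftrightarrow> indep_on T S (\<lambda>i m. A j s * A i m - A i s * A j m)"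
proof
  assume L: "indep_on T (insert j S) A"
  show "indep_on T S (\<lambda>i m. A j s * A i m - A i s * A j m)"
    unfolding indep_on_def
  proof (intro allI impI)
    fix c assume c: "\<forall>m\<in>T. (\<Sum>i\<in>S. c i * (A j s * A i m - A i s * A j m)) = 0"
    \<comment> \<open>Collecting the eliminated relation by rows: a row of \<open>S\<close> acquires
      the factor \<open>A j s\<close>, and row \<open>j\<close> gathers all the subtracted
      multiples.\<close>
    define c' where "c' i = (if i = j then - (\<Sum>i\<in>S. c i * A i s) else A j s * c i)" for i
    have "(\<Sum>i\<in>insert j S. c' i * A i m) = 0" if "m \<in> T" for m
    proof -
      have "(\<Sum>i\<in>S. c' i * A i m) = (\<Sum>i\<in>S. A j s * c i * A i m)"
        using S by (intro sum.cong) (auto simp: c'_def)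
      then have "(\<Sum>i\<in>insert j S. c' i * A i m) = (\<Sum>i\<in>S. c i * (A j s * A i m - A i s * A j m))"
        using S by (simp add: c'_def algebra_simps sum_subtractf sum_distrib_left)
      then show ?thesis using c that by simp
    qed
    then have "\<forall>i\<in>insert j S. c' i = 0" using L unfolding indep_on_def by blast
    then show "\<forall>i\<in>S. c i = 0" using S s by (metis c'_def insertI2 mult_eq_0_iff)
  qed
next
  assume R: "indep_on T S (\<lambda>i m. A j s * A i m - A i s * A j m)"
  show "indep_on T (insert j S) A"
    unfolding indep_on_def
  proof (intro allI impI)
    fix c assume "\<forall>m\<in>T. (\<Sum>i\<in>insert j S. c i * A i m) = 0"
    then have c: "(\<Sum>i\<in>S. c i * A i m) = - (c j * A j m)" if "m \<in> T" for m
      using S that by (simp add: add_eq_0_iff)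
    have "(\<Sum>i\<in>S. c i * (A j s * A i m - A i s * A j m)) = 0" if "m \<in> T" for m
    proof -
      have "(\<Sum>i\<in>S. c i * (A j s * A i m - A i s * A j m))
          = A j s * (\<Sum>i\<in>S. c i * A i m) - A j m * (\<Sum>i\<in>S. c i * A i s)"
        by (simp add: algebra_simps sum_subtractf sum_distrib_left)
      then show ?thesis using c[OF that] c[OF s(1)] by simp
    qed
    then have 0: "\<forall>i\<in>S. c i = 0" using R unfolding indep_on_def by blast
    then have "c j * A j s = 0" using c[OF s(1)] by simp
    then show "\<forall>i\<in>insert j S. c i = 0" using 0 s by simp
  qed
qed

lemma indep_on_pivot:
  assumes "indep_on T (insert j S) A" "finite S" "j \<notin> S"
  obtains s where "s \<in> T" "A j s \<noteq> 0"
proof -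
  have "\<exists>s\<in>T. A j s \<noteq> 0"
  proof (rule ccontr)
    assume *: "\<not> ?thesis"
    have "(\<Sum>i\<in>insert j S. (if i = j then 1 else 0) * A i m) = 0" if "m \<in> T" for m
      by (rule sum.neutral) (use * that in auto)
    then have "(if j = j then 1 else 0 :: 'c) = 0"
      using assms(1) unfolding indep_on_def by fast
    then show False by simp
  qed
  then show thesis using that by blast
qed

lemma indep_on_card_le:
  assumes "finite S" "finite T" "indep_on T S A"
  shows "card S \<le> card T"
  using assms
proof (induction S arbitrary: T A rule: finite_induct)
  case (insert j S)
  obtain s where s: "s \<in> T" "A j s \<noteq> 0"
    using indep_on_pivot[OF insert.prems(2) insert.hyps] by blast
  let ?A = "\<lambda>i m. A j s * A i m - A i s * A j m"
  have "indep_on T S ?A"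
    using indep_on_eliminate[of S j s T A, OF insert.hyps s] insert.prems(2) by blast
  \<comment> \<open>The eliminated rows vanish in the pivot column, so dropping it loses no
    condition, and rows and columns decrease together.\<close>
  moreover have "(\<forall>m\<in>T. (\<Sum>i\<in>S. c i * ?A i m) = 0) \<longleftrightarrow> (\<forall>m\<in>T - {s}. (\<Sum>i\<in>S. c i * ?A i m) = 0)" for c
    by force
  ultimately have "indep_on (T - {s}) S ?A" unfolding indep_on_def by simp
  then have "card S \<le> card (T - {s})" using insert.IH insert.prems(1) by blast
  moreover have "card T = Suc (card (T - {s}))"
    using insert.prems(1) s(1) by (rule card.remove)
  ultimately show ?case using insert.hyps by simp
qed simp

text \<open>Read \<open>Q h u c\<close> as: the function \<open>h\<close> has order at most \<open>u\<close>, and \<open>c\<close> is its leading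
  coefficient at \<open>u\<close> (possibly \<open>0\<close>). With \<open>u\<close> constantly \<open>0\<close> and \<open>c\<close> the value of \<open>h\<close> at a
  point, the lemma says that independence is an open condition.\<close>

lemma indep_on_open:
  fixes Q :: "('x \<Rightarrow> 'k::field) \<Rightarrow> real \<Rightarrow> 'k \<Rightarrow> bool"
  assumes one: "Q (\<lambda>_. 1) 0 1"
    and mult: "\<And>h u c h' u' c'. Q h u c \<Longrightarrow> Q h' u' c' \<Longrightarrow> Q (\<lambda>x. h x * h' x) (u + u') (c * c')"
    and diff: "\<And>h u c h' c'. Q h u c \<Longrightarrow> Q h' u c' \<Longrightarrow> Q (\<lambda>x. h x - h' x) u (c - c')"
    and "finite S"
    and "\<And>i m. i \<in> S \<Longrightarrow> m \<in> T \<Longrightarrow> Q (H i m) (w i) (A i m)"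
    and "indep_on T S A"
  shows "\<exists>p u c. Q p u c \<and> c \<noteq> 0 \<and> (\<forall>x. p x \<noteq> 0 \<longrightarrow> indep_on T S (\<lambda>i m. H i m x))"
  using assms(4-)
proof (induction S arbitrary: H w A rule: finite_induct)
  case empty
  show ?case
    by (rule exI[of _ "\<lambda>_. 1"], rule exI[of _ 0], rule exI[of _ 1]) (simp add: one indep_on_def)
next
  case (insert j S)
  obtain s where s: "s \<in> T" "A j s \<noteq> 0"
    using indep_on_pivot[OF insert.prems(2) insert.hyps] by blast
  have ind: "indep_on T S (\<lambda>i m. A j s * A i m - A i s * A j m)"
    using indep_on_eliminate[of S j s T A, OF insert.hyps s] insert.prems(2) by blast
  \<comment> \<open>Both products have the bound \<open>w j + w i\<close> whatever the column; this
    is why one order \<open>w i\<close> is attached to a whole row.\<close>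
  have Q: "Q (\<lambda>x. H j s x * H i m x - H i s x * H j m x) (w j + w i)
      (A j s * A i m - A i s * A j m)" if "i \<in> S" "m \<in> T" for i m
  proof (rule diff)
    have *: "Q (H j s) (w j) (A j s)" "Q (H i m) (w i) (A i m)" "Q (H i s) (w i) (A i s)"
      "Q (H j m) (w j) (A j m)"
      using insert.prems(1) that s by simp_all
    show "Q (\<lambda>x. H j s x * H i m x) (w j + w i) (A j s * A i m)" using * by (intro mult)
    show "Q (\<lambda>x. H i s x * H j m x) (w j + w i) (A i s * A j m)"
      unfolding add.commute[of "w j"] using * by (intro mult)
  qed
  obtain p u c where p: "Q p u c" "c \<noteq> 0"
    "\<And>x. p x \<noteq> 0 \<Longrightarrow> indep_on T S (\<lambda>i m. H j s x * H i m x - H i s x * H j m x)"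
    using insert.IH[OF Q ind] by blast
  show ?case
  proof (intro exI conjI allI impI)
    \<comment> \<open>The witness is the product of the successive pivots: where none of them
      vanishes, the same elimination can be carried out at \<open>x\<close>.\<close>
    show "Q (\<lambda>x. p x * H j s x) (u + w j) (c * A j s)"
      using mult p insert.prems(1) s by simp
    show "c * A j s \<noteq> 0" using p s by simp
    fix x assume "p x * H j s x \<noteq> 0"
    then have "p x \<noteq> 0" "H j s x \<noteq> 0" by auto
    then show "indep_on T (insert j S) (\<lambda>i m. H i m x)"
      using p(3) indep_on_eliminate[of S j s T "\<lambda>i m. H i m x"] insert.hyps s by auto
  qed
qed

subsection \<open>Leading monomials\<close>

definition monoms :: "nat \<Rightarrow> nat \<Rightarrow> (nat \<Rightarrow>\<^sub>0 nat) set" where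
  "monoms n d = {m. keys m \<subseteq> {..<n} \<and> mdeg m = d}"

definition forms :: "nat \<Rightarrow> nat \<Rightarrow> 'k::comm_ring_1 mpoly set" where
  "forms n d = {f. keys f \<subseteq> monoms n d}"

lemma mdeg_superset: "finite S \<Longrightarrow> keys m \<subseteq> S \<Longrightarrow> mdeg m = (\<Sum>i\<in>S. lookup m i)"
  unfolding mdeg_def by (intro sum.mono_neutral_left) (auto simp: in_keys_iff)

lemma mdeg_add: "mdeg (a + b) = mdeg a + mdeg b"
proof -
  let ?S = "keys a \<union> keys b"
  have "keys (a + b) \<subseteq> ?S" by (rule keys_add)
  then show ?thesis
    by (simp add: mdeg_superset[of ?S] lookup_add sum.distrib)
qed

lemma mweight_add: "mweight n \<omega> (a + b) = mweight n \<omega> a + mweight n \<omega> b"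
  by (simp add: mweight_def lookup_add algebra_simps sum.distrib)

lemma keys_subset_add:
  "keys (a :: nat \<Rightarrow>\<^sub>0 nat) \<subseteq> N \<Longrightarrow> keys b \<subseteq> N \<Longrightarrow> keys (a + b) \<subseteq> N"
  using keys_add[of a b] by blast

lemma monoms_add: "a \<in> monoms n d \<Longrightarrow> b \<in> monoms n e \<Longrightarrow> a + b \<in> monoms n (d + e)"
  by (simp add: monoms_def mdeg_add keys_subset_add)

lemma finite_monoms: "finite (monoms n d)"
proof (rule inj_on_finite)
  show "inj_on (\<lambda>m. restrict (lookup m) {..<n}) (monoms n d)"
  proof (rule inj_onI)
    fix a b assume a: "a \<in> monoms n d" and b: "b \<in> monoms n d"
      and eq: "restrict (lookup a) {..<n} = restrict (lookup b) {..<n}"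
    show "a = b"
    proof (rule poly_mapping_eqI)
      fix i
      show "lookup a i = lookup b i"
      proof (cases "i < n")
        case True
        then show ?thesis using fun_cong[OF eq, of i] by simp
      next
        case False
        then have "i \<notin> keys a" "i \<notin> keys b" using a b by (auto simp: monoms_def)
        then show ?thesis by (simp add: in_keys_iff)
      qed
    qed
  qed
  show "(\<lambda>m. restrict (lookup m) {..<n}) ` monoms n d \<subseteq> {..<n} \<rightarrow>\<^sub>E {..d}"
  proof (rule image_subsetI)
    fix m assume m: "m \<in> monoms n d"
    have "lookup m i \<le> d" if "i < n" for i
    proof -
      have "lookup m i \<le> (\<Sum>i\<in>{..<n}. lookup m i)"
        using that by (intro member_le_sum) auto
      then show ?thesis
        using m mdeg_superset[of "{..<n}" m] by (simp add: monoms_def)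
    qed
    then show "restrict (lookup m) {..<n} \<in> {..<n} \<rightarrow>\<^sub>E {..d}" by auto
  qed
  show "finite ({..<n} \<rightarrow>\<^sub>E {..d})" by (intro finite_PiE) auto
qed

lemma forms_0 [simp]: "0 \<in> forms n d"
  by (simp add: forms_def)

lemma forms_add: "f \<in> forms n d \<Longrightarrow> g \<in> forms n d \<Longrightarrow> f + g \<in> forms n d"
  using keys_add[of f g] unfolding forms_def by blast

lemma forms_sum: "(\<And>i. i \<in> S \<Longrightarrow> f i \<in> forms n d) \<Longrightarrow> (\<Sum>i\<in>S. f i) \<in> forms n d"
  by (induction S rule: infinite_finite_induct) (simp_all add: forms_add)

lemma forms_mult:
  assumes "f \<in> forms n d" "g \<in> forms n e"
  shows "f * g \<in> forms n (d + e)"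
  unfolding forms_def
proof (intro CollectI subsetI)
  fix m assume "m \<in> keys (f * g)"
  then obtain a b where "m = a + b" "a \<in> keys f" "b \<in> keys g"
    using keys_mult[of f g] by blast
  then show "m \<in> monoms n (d + e)"
    using assms unfolding forms_def by (auto intro: monoms_add)
qed

lemma forms_Const: "Const c \<in> forms n 0"
  by (auto simp: forms_def monoms_def Const_def mdeg_def)

lemma forms_1: "1 \<in> forms n 0"
  using forms_Const[of 1] by simp

lemma forms_scale: "f \<in> forms n d \<Longrightarrow> Const c * f \<in> forms n d"
  using forms_mult[OF forms_Const] by force

lemma forms_single: "m \<in> monoms n d \<Longrightarrow> single m c \<in> forms n d"
  by (simp add: forms_def)

lemma forms_Var: "i < n \<Longrightarrow> Var i \<in> forms n 1"
  unfolding Var_def by (rule forms_single) (simp add: monoms_def mdeg_def)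

lemma forms_power: "f \<in> forms n d \<Longrightarrow> f ^ k \<in> forms n (d * k)"
  by (induction k) (use forms_1 in \<open>auto simp: forms_mult\<close>)

lemma forms_prod:
  "(\<And>i. i \<in> S \<Longrightarrow> f i \<in> forms n (d i)) \<Longrightarrow> (\<Prod>i\<in>S. f i) \<in> forms n (\<Sum>i\<in>S. d i)"
  by (induction S rule: infinite_finite_induct) (use forms_1 in \<open>auto simp: forms_mult\<close>)

lemma forms_polyring: "forms n d \<subseteq> polyring n"
  by (auto simp: forms_def polyring_def monoms_def)

text \<open>\<open>hcomp\<close>, \<open>init_form\<close> and later \<open>wpart\<close> all select
  the terms in some set of monomials, so linearity and supports are settled once.\<close>

definition restr :: "(nat \<Rightarrow>\<^sub>0 nat) set \<Rightarrow> 'k::comm_ring_1 mpoly \<Rightarrow> 'k mpoly" where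
  "restr T f = (\<Sum>m\<in>{m \<in> keys f. m \<in> T}. single m (lookup f m))"

lemma lookup_restr: "lookup (restr T f) m = (if m \<in> T then lookup f m else 0)"
  unfolding restr_def by (auto simp: lookup_sum lookup_single when_def in_keys_iff)

lemma keys_restr: "keys (restr T f) = keys f \<inter> T"
  by (auto simp: in_keys_iff lookup_restr split: if_splits)

lemma restr_add: "restr T (f + g) = restr T f + restr T g"
  by (rule poly_mapping_eqI) (simp add: lookup_restr lookup_add)

lemma restr_0 [simp]: "restr T 0 = 0"
  by (simp add: restr_def)

lemma restr_sum: "restr T (\<Sum>i\<in>S. f i) = (\<Sum>i\<in>S. restr T (f i))"
  by (induction S rule: infinite_finite_induct) (simp_all add: restr_add)

lemma restr_scale: "restr T (Const c * f) = Const c * restr T f"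
  by (rule poly_mapping_eqI) (simp add: lookup_restr)

lemma restr_id: "keys f \<subseteq> T \<Longrightarrow> restr T f = f"
  by (rule poly_mapping_eqI) (auto simp: lookup_restr in_keys_iff subset_iff)

lemma restr_disjoint: "keys f \<inter> T = {} \<Longrightarrow> restr T f = 0"
  by (rule poly_mapping_eqI) (auto simp: lookup_restr in_keys_iff)

lemma hcomp_restr: "hcomp d f = restr {m. mdeg m = d} f"
  by (simp add: hcomp_def restr_def)

lemma init_form_restr:
  "init_form n \<omega> f = restr {m. mweight n \<omega> m = Max (mweight n \<omega> ` keys f)} f"
  by (simp add: init_form_def restr_def)

lemma hcomp_forms: "f \<in> polyring n \<Longrightarrow> hcomp d f \<in> forms n d"
  by (auto simp: forms_def hcomp_restr keys_restr monoms_def polyring_def)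

lemma hcomp_eq: "f \<in> forms n e \<Longrightarrow> hcomp d f = (if d = e then f else 0)"
  by (auto simp: hcomp_restr forms_def monoms_def intro!: restr_id restr_disjoint)

definition lin_closed :: "'k::comm_ring_1 mpoly set \<Rightarrow> bool" where
  "lin_closed V \<longleftrightarrow> 0 \<in> V \<and> (\<forall>f\<in>V. \<forall>g\<in>V. f + g \<in> V) \<and> (\<forall>c. \<forall>f\<in>V. Const c * f \<in> V)"

lemma lin_closed_sum:
  "lin_closed V \<Longrightarrow> (\<And>i. i \<in> S \<Longrightarrow> f i \<in> V) \<Longrightarrow> (\<Sum>i\<in>S. Const (c i) * f i) \<in> V"
  by (induction S rule: infinite_finite_induct) (auto simp: lin_closed_def)

text \<open>A monomial order refining the weight; it only serves to count dimensions by means of leading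
  monomials.\<close>

definition mle :: "nat \<Rightarrow> (nat \<Rightarrow> real) \<Rightarrow> (nat \<Rightarrow>\<^sub>0 nat) \<Rightarrow> (nat \<Rightarrow>\<^sub>0 nat) \<Rightarrow> bool" where
  "mle n \<omega> a b \<longleftrightarrow> mweight n \<omega> a < mweight n \<omega> b \<or> mweight n \<omega> a = mweight n \<omega> b \<and> a \<le> b"

lemma mle_refl: "mle n \<omega> a a"
  by (simp add: mle_def)

lemma mle_trans: "mle n \<omega> a b \<Longrightarrow> mle n \<omega> b c \<Longrightarrow> mle n \<omega> a c"
  by (auto simp: mle_def)

lemma mle_antisym: "mle n \<omega> a b \<Longrightarrow> mle n \<omega> b a \<Longrightarrow> a = b"
  by (auto simp: mle_def)

lemma mle_total: "mle n \<omega> a b \<or> mle n \<omega> b a"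
  by (auto simp: mle_def)

lemma mle_add: "mle n \<omega> a b \<Longrightarrow> mle n \<omega> (a + c) (b + c)"
  by (auto simp: mle_def mweight_add add_right_mono)

lemma mle_mweight: "mle n \<omega> a b \<Longrightarrow> mweight n \<omega> a \<le> mweight n \<omega> b"
  by (auto simp: mle_def)

lemma mle_greatest:
  assumes "finite S" "S \<noteq> {}"
  obtains m where "m \<in> S" "\<And>a. a \<in> S \<Longrightarrow> mle n \<omega> a m"
proof -
  have "\<exists>m\<in>S. \<forall>a\<in>S. mle n \<omega> a m"
    using assms
  proof (induction S rule: finite_ne_induct)
    case (insert x S)
    then obtain m where "m \<in> S" "\<forall>a\<in>S. mle n \<omega> a m" by blast
    then show ?case using mle_total[of n \<omega> x m] mle_refl[of n \<omega> x] mle_trans[of n \<omega> _ m x]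
      by (metis insert_iff)
  qed (simp add: mle_refl)
  then show thesis using that by blast
qed

definition is_lead :: "nat \<Rightarrow> (nat \<Rightarrow> real) \<Rightarrow> 'k::zero mpoly \<Rightarrow> (nat \<Rightarrow>\<^sub>0 nat) \<Rightarrow> bool" where
  "is_lead n \<omega> f m \<longleftrightarrow> m \<in> keys f \<and> (\<forall>a\<in>keys f. mle n \<omega> a m)"

definition lead_monoms :: "nat \<Rightarrow> (nat \<Rightarrow> real) \<Rightarrow> 'k::zero mpoly set \<Rightarrow> (nat \<Rightarrow>\<^sub>0 nat) set" where
  "lead_monoms n \<omega> V = {m. \<exists>f\<in>V. is_lead n \<omega> f m}"

lemma is_lead_exists:
  assumes "f \<noteq> 0"
  obtains m where "is_lead n \<omega> f m"
  using mle_greatest[of "keys f" n \<omega>] assms unfolding is_lead_def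
  by (metis finite_keys keys_eq_empty)

lemma lead_monoms_subset: "V \<subseteq> forms n d \<Longrightarrow> lead_monoms n \<omega> V \<subseteq> monoms n d"
  by (auto simp: lead_monoms_def is_lead_def forms_def)

text \<open>A final segment of the order in degree \<open>d\<close>. Two kinds matter: the monomials
  above a given weight, for the invariance, and those from a given monomial on, to recover a set
  from its counts.\<close>

definition upset :: "nat \<Rightarrow> (nat \<Rightarrow> real) \<Rightarrow> nat \<Rightarrow> (nat \<Rightarrow>\<^sub>0 nat) set \<Rightarrow> bool" where
  "upset n \<omega> d T \<longleftrightarrow> T \<subseteq> monoms n d \<and> (\<forall>m\<in>T. \<forall>a\<in>monoms n d. mle n \<omega> m a \<longrightarrow> a \<in> T)"

text \<open>If an element of \<open>V\<close> has a term in \<open>T\<close>, its leading monomial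
  also lies in \<open>T\<close>. So an element vanishing on the leading monomials in
  \<open>T\<close> vanishes on all of \<open>T\<close>, and independence survives on these few
  columns.\<close>

lemma indep_card_lead_monoms:
  fixes V :: "'k::field mpoly set"
  assumes V: "lin_closed V" "V \<subseteq> forms n d" and T: "upset n \<omega> d T"
    and S: "finite S" "\<And>i. i \<in> S \<Longrightarrow> f i \<in> V" and ind: "indep_on T S (\<lambda>i. lookup (f i))"
  shows "card S \<le> card (lead_monoms n \<omega> V \<inter> T)"
proof (rule indep_on_card_le[OF S(1)])
  show "finite (lead_monoms n \<omega> V \<inter> T)"
    using finite_subset[OF lead_monoms_subset[OF V(2)] finite_monoms] by blast
  show "indep_on (lead_monoms n \<omega> V \<inter> T) S (\<lambda>i. lookup (f i))"
    unfolding indep_on_def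
  proof (intro allI impI)
    fix c assume c: "\<forall>m\<in>lead_monoms n \<omega> V \<inter> T. (\<Sum>i\<in>S. c i * lookup (f i) m) = 0"
    define h where "h = (\<Sum>i\<in>S. Const (c i) * f i)"
    have lookup_h: "lookup h m = (\<Sum>i\<in>S. c i * lookup (f i) m)" for m
      by (simp add: h_def lookup_sum)
    have hV: "h \<in> V" unfolding h_def using V(1) S(2) by (rule lin_closed_sum)
    have "lookup h m = 0" if m: "m \<in> T" for m
    proof (rule ccontr)
      assume "lookup h m \<noteq> 0"
      then have mk: "m \<in> keys h" by (simp add: in_keys_iff)
      then have "h \<noteq> 0" by auto
      then obtain l where l: "is_lead n \<omega> h l" by (rule is_lead_exists)
      then have "l \<in> lead_monoms n \<omega> V" using hV by (auto simp: lead_monoms_def)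
      moreover have "l \<in> T"
        using T m l mk lead_monoms_subset[OF V(2)] calculation
        unfolding upset_def is_lead_def by blast
      ultimately have "lookup h l = 0" using c by (simp add: lookup_h)
      then show False using l by (simp add: is_lead_def in_keys_iff)
    qed
    then show "\<forall>i\<in>S. c i = 0" using ind by (simp add: indep_on_def lookup_h)
  qed
qed

text \<open>The greatest \<open>m\<close> with \<open>c m\<close> nonzero cannot be cancelled: every
  other \<open>f i\<close> that contributes has a smaller leading monomial.\<close>

lemma lookup_sum_lead:
  fixes f :: "(nat \<Rightarrow>\<^sub>0 nat) \<Rightarrow> 'k::field mpoly"
  assumes S: "finite S" "\<And>m. m \<in> S \<Longrightarrow> is_lead n \<omega> (f m) m" and c: "\<exists>m\<in>S. c m \<noteq> 0"
  obtains m where "m \<in> S" "lookup (\<Sum>i\<in>S. Const (c i) * f i) m \<noteq> 0"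
proof -
  obtain m where m: "m \<in> S" "c m \<noteq> 0" "\<And>a. a \<in> S \<Longrightarrow> c a \<noteq> 0 \<Longrightarrow> mle n \<omega> a m"
    using mle_greatest[of "{m\<in>S. c m \<noteq> 0}" n \<omega>] S(1) c
    by (metis (mono_tags, lifting) empty_iff finite_subset mem_Collect_eq subsetI)
  have "c i * lookup (f i) m = 0" if "i \<in> S - {m}" for i
  proof (rule ccontr)
    assume "c i * lookup (f i) m \<noteq> 0"
    then have "c i \<noteq> 0" "m \<in> keys (f i)" by (auto simp: in_keys_iff)
    then have "mle n \<omega> i m" "mle n \<omega> m i" using m that S(2) by (auto simp: is_lead_def)
    then show False using that mle_antisym by blast
  qed
  then have "lookup (\<Sum>i\<in>S. Const (c i) * f i) m = c m * lookup (f m) m"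
    unfolding lookup_sum lookup_Const_mult using S(1) m(1)
    by (subst sum.remove[of S m]) (simp_all add: sum.neutral)
  also have "\<dots> \<noteq> 0" using m S(2) by (simp add: is_lead_def in_keys_iff)
  finally show thesis using that m(1) by blast
qed

text \<open>Triangularity with respect to the order. With \<open>indep_card_lead_monoms\<close> it
  identifies the rank on an upset with the number of leading monomials there.\<close>

lemma indep_on_lead:
  fixes f :: "(nat \<Rightarrow>\<^sub>0 nat) \<Rightarrow> 'k::field mpoly"
  assumes "finite S" "\<And>m. m \<in> S \<Longrightarrow> is_lead n \<omega> (f m) m" "S \<subseteq> T"
  shows "indep_on T S (\<lambda>i. lookup (f i))"
  unfolding indep_on_def
proof (intro allI impI, rule ccontr)
  fix c assume c: "\<forall>m\<in>T. (\<Sum>i\<in>S. c i * lookup (f i) m) = 0" and "\<not> (\<forall>i\<in>S. c i = 0)"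
  then obtain m where "m \<in> S" "lookup (\<Sum>i\<in>S. Const (c i) * f i) m \<noteq> 0"
    using lookup_sum_lead[of S n \<omega> f c] assms by blast
  then show False using c assms(3) by (auto simp: lookup_sum)
qed

subsection \<open>Linear changes of coordinates with generic matrices\<close>

lemma base_expansion_inj:
  fixes a b :: "nat \<Rightarrow> nat"
  assumes "\<forall>i<N. a i < B" "\<forall>i<N. b i < B" "(\<Sum>i<N. a i * B ^ i) = (\<Sum>i<N. b i * B ^ i)"
  shows "\<forall>i<N. a i = b i"
  using assms
proof (induction N arbitrary: a b)
  case (Suc N)
  have shift: "(\<Sum>i<Suc N. c i * B ^ i) = c 0 + B * (\<Sum>i<N. c (Suc i) * B ^ i)" for c :: "nat \<Rightarrow> nat"
    by (subst sum.lessThan_Suc_shift) (simp add: sum_distrib_left ac_simps)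
  have eq: "a 0 + B * (\<Sum>i<N. a (Suc i) * B ^ i) = b 0 + B * (\<Sum>i<N. b (Suc i) * B ^ i)"
    using Suc.prems(3) by (simp only: shift)
  have lt: "a 0 < B" "b 0 < B" using Suc.prems by auto
  have 0: "a 0 = b 0" using arg_cong[OF eq, of "\<lambda>x. x mod B"] lt by simp
  have B: "B \<noteq> 0" using lt by simp
  have "(\<Sum>i<N. a (Suc i) * B ^ i) = (\<Sum>i<N. b (Suc i) * B ^ i)"
    using eq unfolding 0 add_left_cancel mult_cancel1 using B by blast
  then have IH: "\<forall>i<N. a (Suc i) = b (Suc i)"
    by (intro Suc.IH) (use Suc.prems in auto)
  show ?case
  proof (intro allI impI)
    fix i assume "i < Suc N"
    then show "a i = b i" using 0 IH by (cases i) auto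
  qed
qed simp

text \<open>Kronecker's substitution \<open>X\<^sub>i \<mapsto> s\<^bsup>B\<^sup>i\<^esup>\<close> reduces the claim to one variable.\<close>

lemma peval_nonzero:
  fixes p :: "'k::field mpoly"
  assumes inf: "infinite (UNIV :: 'k set)" and p: "p \<in> polyring N" "p \<noteq> 0"
  obtains x where "peval x p \<noteq> 0"
proof -
  \<comment> \<open>\<open>B\<close> exceeds every exponent occurring in \<open>p\<close>, so the
    exponents of a monomial are the base-\<open>B\<close> digits of \<open>\<kappa> m\<close>, and
    distinct monomials keep distinct powers.\<close>
  define B where "B = Suc (\<Sum>m\<in>keys p. \<Sum>i<N. lookup m i)"
  define \<kappa> where "\<kappa> m = (\<Sum>i<N. lookup m i * B ^ i)" for m :: "nat \<Rightarrow>\<^sub>0 nat"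
  have keysN: "keys m \<subseteq> {..<N}" if "m \<in> keys p" for m
    using p(1) that by (auto simp: polyring_def)
  have lt: "\<forall>i<N. lookup m i < B" if "m \<in> keys p" for m
  proof (intro allI impI)
    fix i assume "i < N"
    then have "lookup m i \<le> (\<Sum>i<N. lookup m i)" by (intro member_le_sum) auto
    also have "\<dots> \<le> (\<Sum>m\<in>keys p. \<Sum>i<N. lookup m i)"
      using that by (intro member_le_sum[where f = "\<lambda>m. \<Sum>i<N. lookup m i"]) auto
    finally show "lookup m i < B" by (simp add: B_def)
  qed
  have inj: "a = b" if ab: "a \<in> keys p" "b \<in> keys p" and "\<kappa> a = \<kappa> b" for a b
  proof (rule poly_mapping_eqI)
    fix i
    have "\<forall>i<N. lookup a i = lookup b i"
      using base_expansion_inj[OF lt[OF ab(1)] lt[OF ab(2)]] that(3) by (simp add: \<kappa>_def)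
    then show "lookup a i = lookup b i"
      using keysN[OF ab(1)] keysN[OF ab(2)]
      by (metis in_keys_iff in_mono lessThan_iff)
  qed
  define q where "q = (\<Sum>m\<in>keys p. Polynomial.monom (lookup p m) (\<kappa> m))"
  obtain m where m: "m \<in> keys p" using p(2) by (metis all_not_in_conv keys_eq_empty)
  have "coeff q (\<kappa> m) = (\<Sum>a\<in>keys p. if a = m then lookup p a else 0)"
    unfolding q_def coeff_sum coeff_monom using inj m by (intro sum.cong) auto
  also have "\<dots> = lookup p m" using m by simp
  finally have "coeff q (\<kappa> m) \<noteq> 0" using m by (simp add: in_keys_iff)
  then have "q \<noteq> 0" by auto
  then have "finite {s. poly q s = 0}" by (rule poly_roots_finite)
  then obtain s where s: "poly q s \<noteq> 0"
    using inf by (metis (mono_tags, lifting) finite_subset mem_Collect_eq subsetI)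
  have "mon (\<lambda>i. s ^ (B ^ i)) m = s ^ \<kappa> m" if "m \<in> keys p" for m
    using mon_superset[OF finite_lessThan keysN[OF that], of "\<lambda>i. s ^ (B ^ i)"]
    by (simp add: \<kappa>_def power_sum power_mult[symmetric] mult.commute)
  then have "peval (\<lambda>i. s ^ (B ^ i)) p = poly q s"
    unfolding peval.E_def q_def poly_sum poly_monom by (intro sum.cong) auto
  then show thesis using that s by metis
qed

abbreviation mpeval :: "nat \<Rightarrow> 'k::comm_ring_1 mpoly \<Rightarrow> (nat \<Rightarrow> nat \<Rightarrow> 'k) \<Rightarrow> 'k" where
  "mpeval n p h \<equiv> peval (mat_point n h) p"

lemma mpeval_nonzero:
  fixes p :: "'k::field mpoly"
  assumes inf: "infinite (UNIV :: 'k set)" and p: "p \<in> polyring (n * n)" "p \<noteq> 0"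
  obtains h where "h \<in> matrices n" "mpeval n p h \<noteq> 0"
proof -
  obtain x where x: "peval x p \<noteq> 0" using peval_nonzero[OF inf p] .
  define h where "h i j = (if i < n \<and> j < n then x (i * n + j) else 0)" for i j
  have "mat_point n h k = x k" if "m \<in> keys p" "k \<in> keys m" for m k
  proof -
    have "k < n * n" using p(1) that by (auto simp: polyring_def)
    moreover from this have "0 < n" by (cases n) auto
    ultimately show ?thesis by (simp add: mat_point_def h_def less_mult_imp_div_less)
  qed
  then have "mpeval n p h = peval x p"
    unfolding peval_def by (intro sum.cong prod.cong arg_cong2[of _ _ _ _ "(*)"]) auto
  then show thesis using that[of h] x by (simp add: h_def matrices_def)
qed

lemma mpeval_Var: "i < n \<Longrightarrow> j < n \<Longrightarrow> mpeval n (Var (i * n + j)) h = h i j"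
  by (simp add: peval.Var mat_point_def)

lemma Var_entry_polyring:
  assumes "i < n" "j < n"
  shows "Var (i * n + j) \<in> polyring (n * n)"
proof (rule polyring_Var)
  have "i * n + j < Suc i * n" using assms by simp
  also have "\<dots> \<le> n * n" using assms by (intro mult_right_mono) auto
  finally show "i * n + j < n * n" .
qed

text \<open>Polynomials whose coefficients are polynomial functions of the matrix entries.
  Generating the families from single terms reduces closure under products to products of terms
  instead of convolutions of coefficients.\<close>

inductive poly_family :: "nat \<Rightarrow> ((nat \<Rightarrow> nat \<Rightarrow> 'k::comm_ring_1) \<Rightarrow> 'k mpoly) \<Rightarrow> bool" for n where
  single: "p \<in> polyring (n * n) \<Longrightarrow> poly_family n (\<lambda>h. single m (mpeval n p h))"
| add: "poly_family n F \<Longrightarrow> poly_family n G \<Longrightarrow> poly_family n (\<lambda>h. F h + G h)"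

lemma poly_family_0: "poly_family n (\<lambda>_. 0)"
  using poly_family.single[of 0 n 0] by simp

lemma poly_family_sum:
  "(\<And>i. i \<in> S \<Longrightarrow> poly_family n (F i)) \<Longrightarrow> poly_family n (\<lambda>h. \<Sum>i\<in>S. F i h)"
  by (induction S rule: infinite_finite_induct) (simp_all add: poly_family_0 poly_family.add)

lemma poly_family_const: "poly_family n (\<lambda>_. f)"
proof -
  have "poly_family n (\<lambda>_. \<Sum>m\<in>keys f. single m (lookup f m))"
  proof (rule poly_family_sum)
    fix m
    show "poly_family n (\<lambda>_. single m (lookup f m))"
      using poly_family.single[of "Const (lookup f m)" n m] by (simp add: peval.Const)
  qed
  then show ?thesis by (simp add: sum_single_lookup)
qed

lemma poly_family_mult:
  assumes "poly_family n F" "poly_family n G"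
  shows "poly_family n (\<lambda>h. F h * G h)"
  using assms
proof (induction F rule: poly_family.induct)
  case (single p m)
  from single(2,1) show ?case
  proof (induction G rule: poly_family.induct)
    case (single q l)
    show ?case
      using poly_family.single[OF polyring_mult[OF single(2,1)], of "m + l"]
      by (simp add: mult_single peval.mult)
  next
    case (add F G)
    then show ?case using poly_family.add by (simp add: distrib_left)
  qed
next
  case (add F G)
  then show ?case using poly_family.add by (simp add: distrib_right)
qed

lemma poly_family_prod:
  "(\<And>i. i \<in> S \<Longrightarrow> poly_family n (F i)) \<Longrightarrow> poly_family n (\<lambda>h. \<Prod>i\<in>S. F i h)"
  by (induction S rule: infinite_finite_induct) (simp_all add: poly_family_const poly_family_mult)

lemma poly_family_power: "poly_family n F \<Longrightarrow> poly_family n (\<lambda>h. F h ^ k)"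
  by (induction k) (simp_all add: poly_family_const poly_family_mult)

lemma poly_family_lookup:
  assumes "poly_family n F"
  shows "\<exists>p\<in>polyring (n * n). (\<lambda>h. lookup (F h) m) = mpeval n p"
  using assms
proof (induction F rule: poly_family.induct)
  case (single p l)
  show ?case
  proof (cases "l = m")
    case True
    then show ?thesis using single by (auto simp: lookup_single)
  next
    case False
    then show ?thesis by (intro bexI[of _ 0]) (auto simp: lookup_single when_def)
  qed
next
  case (add F G)
  then obtain p q where "p \<in> polyring (n * n)" "(\<lambda>h. lookup (F h) m) = mpeval n p"
    "q \<in> polyring (n * n)" "(\<lambda>h. lookup (G h) m) = mpeval n q" by blast
  then show ?case
    by (intro bexI[of _ "p + q"]) (auto simp: lookup_add peval.add polyring_add fun_eq_iff)
qed

definition lsub :: "nat \<Rightarrow> (nat \<Rightarrow> nat \<Rightarrow> 'k::comm_ring_1) \<Rightarrow> 'k mpoly \<Rightarrow> 'k mpoly" where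
  "lsub n h = subst (\<lambda>j. \<Sum>i<n. Const (h i j) * Var i)"

lemma act_lsub: "act n h J = lsub n h ` J"
  by (simp add: act_def lsub_def)

lemma lsub_0 [simp]: "lsub n h 0 = 0"
  by (simp add: lsub_def)

lemma lsub_add: "lsub n h (f + g) = lsub n h f + lsub n h g"
  by (simp add: lsub_def subst.add)

lemma lsub_diff: "lsub n h (f - g) = lsub n h f - lsub n h g"
  by (simp add: lsub_def subst.diff)

lemma lsub_mult: "lsub n h (f * g) = lsub n h f * lsub n h g"
  by (simp add: lsub_def subst.mult)

lemma lsub_Const: "lsub n h (Const c) = Const c"
  by (simp add: lsub_def subst.Const)

lemma lsub_scale: "lsub n h (Const c * f) = Const c * lsub n h f"
  by (simp add: lsub_mult lsub_Const)

lemma lsub_sum: "lsub n h (\<Sum>i\<in>S. f i) = (\<Sum>i\<in>S. lsub n h (f i))"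
  by (simp add: lsub_def subst.sum)

lemma poly_family_lsub:
  assumes "f \<in> polyring n"
  shows "poly_family n (\<lambda>h. lsub n h f)"
  unfolding lsub_def subst_def
proof (intro poly_family_sum poly_family_mult poly_family_const poly_family_prod poly_family_power)
  fix m j i assume "m \<in> keys f" "j \<in> keys m" "i \<in> {..<n}"
  then have "i < n" "j < n" using assms by (auto simp: polyring_def)
  then show "poly_family n (\<lambda>h. Const (h i j))"
    using poly_family.single[OF Var_entry_polyring, of i n j 0] by (simp add: Const_def mpeval_Var)
qed

lemma lsub_forms:
  assumes "f \<in> forms n d"
  shows "lsub n h f \<in> forms n d"
  unfolding lsub_def subst_def
proof (rule forms_sum)
  fix m assume "m \<in> keys f"
  then have d: "d = 0 + (\<Sum>j\<in>keys m. 1 * lookup m j)"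
    using assms by (auto simp: forms_def monoms_def mdeg_def)
  show "Const (lookup f m) * (\<Prod>j\<in>keys m. (\<Sum>i<n. Const (h i j) * Var i) ^ lookup m j) \<in> forms n d"
    unfolding d
    by (intro forms_mult forms_Const forms_prod forms_power forms_sum forms_scale forms_Var) auto
qed

lemma lsub_polyring: "lsub n h f \<in> polyring n"
  unfolding lsub_def subst_def
  by (intro polyring_sum polyring_mult polyring_Const polyring_prod polyring_power polyring_Var) auto

definition mmult :: "nat \<Rightarrow> (nat \<Rightarrow> nat \<Rightarrow> 'k::comm_ring_1) \<Rightarrow> (nat \<Rightarrow> nat \<Rightarrow> 'k) \<Rightarrow> nat \<Rightarrow> nat \<Rightarrow> 'k" where
  "mmult n b g i j = (\<Sum>k<n. b i k * g k j)"

text \<open>Substituting linear forms into linear forms multiplies their matrices. Singular factors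
  are allowed, so a translate by \<open>b\<close> and a diagonal matrix is again the image under a
  single matrix.\<close>

lemma lsub_lsub: "lsub n b (lsub n g f) = lsub n (mmult n b g) f"
proof -
  have "subst (\<lambda>j. \<Sum>i<n. Const (b i j) * Var i) (\<Sum>i<n. Const (g i j) * Var i)
      = (\<Sum>i<n. Const (mmult n b g i j) * Var i)" for j
    by (simp add: subst.sum subst.mult subst.Const subst.Var mmult_def Const_sum Const_mult
        sum_distrib_left sum_distrib_right ac_simps)
      (rule sum.swap)
  then show ?thesis by (simp add: lsub_def subst_subst)
qed

text \<open>For homogeneous \<open>I\<close> this is the degree-\<open>d\<close> part of
  \<open>g(I)\<close>. The degree is cut out before substituting, so the source space does not
  depend on \<open>g\<close> and its elements can be carried from one matrix to another.\<close>

definition vspace :: "nat \<Rightarrow> 'k::comm_ring_1 mpoly set \<Rightarrow> nat \<Rightarrow> (nat \<Rightarrow> nat \<Rightarrow> 'k) \<Rightarrow> 'k mpoly set" where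
  "vspace n I d g = lsub n g ` (I \<inter> forms n d)"

lemma vspace_forms: "vspace n I d g \<subseteq> forms n d"
  by (auto simp: vspace_def lsub_forms)

lemma lin_closed_vspace:
  assumes "lin_closed I"
  shows "lin_closed (vspace n I d g)"
  unfolding lin_closed_def
proof (intro conjI ballI allI)
  show "0 \<in> vspace n I d g"
    using assms by (auto simp: vspace_def lin_closed_def intro!: image_eqI[of _ _ 0])
next
  fix f h assume "f \<in> vspace n I d g" "h \<in> vspace n I d g"
  then obtain f' h' where "f = lsub n g f'" "h = lsub n g h'" "f' \<in> I" "h' \<in> I"
    "f' \<in> forms n d" "h' \<in> forms n d" by (auto simp: vspace_def)
  then show "f + h \<in> vspace n I d g"
    using assms
    by (auto simp: vspace_def lin_closed_def forms_add lsub_add intro!: image_eqI[of _ _ "f' + h'"])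
next
  fix c f assume "f \<in> vspace n I d g"
  then obtain f' where "f = lsub n g f'" "f' \<in> I" "f' \<in> forms n d" by (auto simp: vspace_def)
  then show "Const c * f \<in> vspace n I d g"
    using assms
    by (auto simp: vspace_def lin_closed_def forms_scale lsub_mult lsub_Const
        intro!: image_eqI[of _ _ "Const c * f'"])
qed

text \<open>Let \<open>m\<close> be the greatest element of the symmetric difference. On the final
  segment starting at \<open>m\<close>, the two sets differ in \<open>m\<close> alone, so their
  counts differ.\<close>

lemma upset_card_inj:
  assumes AB: "A \<subseteq> monoms n d" "B \<subseteq> monoms n d"
    and eq: "\<And>T. upset n \<omega> d T \<Longrightarrow> card (A \<inter> T) = card (B \<inter> T)"
  shows "A = B"
proof (rule ccontr)
  let ?D = "(A - B) \<union> (B - A)"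
  assume "A \<noteq> B"
  moreover have fin: "finite A" "finite B" using AB finite_monoms finite_subset by blast+
  ultimately obtain m where m: "m \<in> ?D" "\<And>a. a \<in> ?D \<Longrightarrow> mle n \<omega> a m"
    using mle_greatest[of ?D n \<omega>] by blast
  define T where "T = {a \<in> monoms n d. mle n \<omega> m a}"
  have "upset n \<omega> d T" unfolding upset_def T_def using mle_trans by blast
  then have card: "card (A \<inter> T) = card (B \<inter> T)" by (rule eq)
  have mT: "m \<in> T" using m AB mle_refl by (auto simp: T_def)
  have D: "a = m" if "a \<in> ?D" "a \<in> T" for a
    using m(2)[OF that(1)] that(2) mle_antisym by (auto simp: T_def)
  from m(1) have "A \<inter> T \<subset> B \<inter> T \<or> B \<inter> T \<subset> A \<inter> T" using D mT by blast
  then show False using card fin by (metis finite_Int nat_neq_iff psubset_card_mono)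
qed

text \<open>For an upset \<open>T\<close>, the cardinality of \<open>lead_monoms n \<omega> V \<inter> T\<close> is the rank of the projection
  of \<open>V\<close> to the span of \<open>T\<close>.\<close>

lemma rank_semicontinuous:
  fixes I :: "'k::field mpoly set"
  assumes I: "lin_closed I" and T: "upset n \<omega> d T"
  obtains p where "p \<in> polyring (n * n)" "mpeval n p g\<^sub>0 \<noteq> 0"
    "\<And>g. mpeval n p g \<noteq> 0 \<Longrightarrow> card (lead_monoms n \<omega> (vspace n I d g\<^sub>0) \<inter> T)
       \<le> card (lead_monoms n \<omega> (vspace n I d g) \<inter> T)"
proof -
  let ?S = "lead_monoms n \<omega> (vspace n I d g\<^sub>0) \<inter> T"
  have fin: "finite ?S"
    using finite_subset[OF lead_monoms_subset[OF vspace_forms] finite_monoms] by blast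
  \<comment> \<open>The preimages in \<open>I\<close> are chosen once, for \<open>g\<^sub>0\<close>;
    afterwards only the matrix varies.\<close>
  have "\<forall>m\<in>?S. \<exists>f. f \<in> I \<inter> forms n d \<and> is_lead n \<omega> (lsub n g\<^sub>0 f) m"
    by (auto simp: lead_monoms_def vspace_def)
  then obtain f where f: "\<And>m. m \<in> ?S \<Longrightarrow> f m \<in> I \<inter> forms n d"
    "\<And>m. m \<in> ?S \<Longrightarrow> is_lead n \<omega> (lsub n g\<^sub>0 (f m)) m"
    by metis
  have ind: "indep_on T ?S (\<lambda>i. lookup (lsub n g\<^sub>0 (f i)))"
    by (rule indep_on_lead) (use fin f in auto)
  \<comment> \<open>Here \<open>c\<close> is the value at the point \<open>g\<^sub>0\<close>, and
    the order \<open>u\<close> imposes no constraint.\<close>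
  let ?Q = "\<lambda>h (u::real) c. (\<exists>p\<in>polyring (n * n). h = mpeval n p) \<and> c = h g\<^sub>0"
  have "\<exists>p u c. ?Q p u c \<and> c \<noteq> 0 \<and>
      (\<forall>g. p g \<noteq> 0 \<longrightarrow> indep_on T ?S (\<lambda>i m. lookup (lsub n g (f i)) m))"
  proof (rule indep_on_open[where Q = ?Q and w = "\<lambda>_. 0", OF _ _ _ fin _ ind])
    show "?Q (\<lambda>_. 1) 0 1" by (auto intro!: bexI[of _ 1])
  next
    fix h u c h' u' c' assume "?Q h u c" "?Q h' u' c'"
    then show "?Q (\<lambda>x. h x * h' x) (u + u') (c * c')"
      by (auto simp: peval.mult[symmetric] polyring_mult)
  next
    fix h u c h' c' assume "?Q h u c" "?Q h' u c'"
    then show "?Q (\<lambda>x. h x - h' x) u (c - c')"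
      by (auto simp: peval.diff[symmetric] polyring_diff)
  next
    fix i m assume "i \<in> ?S"
    then have "f i \<in> polyring n" using f(1) forms_polyring by blast
    then show "?Q (\<lambda>g. lookup (lsub n g (f i)) m) 0 (lookup (lsub n g\<^sub>0 (f i)) m)"
      using poly_family_lookup[OF poly_family_lsub] by blast
  qed
  then obtain p where p: "p \<in> polyring (n * n)" "mpeval n p g\<^sub>0 \<noteq> 0"
    "\<And>g. mpeval n p g \<noteq> 0 \<Longrightarrow> indep_on T ?S (\<lambda>i. lookup (lsub n g (f i)))"
    by auto
  have "card ?S \<le> card (lead_monoms n \<omega> (vspace n I d g) \<inter> T)" if "mpeval n p g \<noteq> 0" for g
    by (rule indep_card_lead_monoms[OF lin_closed_vspace[OF I] vspace_forms T fin _ p(3)[OF that]])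
      (use f(1) in \<open>auto simp: vspace_def\<close>)
  then show thesis using that p by blast
qed

text \<open>Each rank is bounded by the number of monomials, so it attains a maximum, and by
  semicontinuity it does so on an open set. A degree has finitely many upsets, so one product of
  polynomials maximizes all ranks at once, and the maximal counts determine
  \<open>G\<close>.\<close>

lemma generic_lead_monoms:
  fixes I :: "'k::field mpoly set"
  assumes inf: "infinite (UNIV :: 'k set)" and I: "lin_closed I"
  obtains p G where "p \<in> polyring (n * n)" "p \<noteq> 0"
    "\<And>g. mpeval n p g \<noteq> 0 \<Longrightarrow> lead_monoms n \<omega> (vspace n I d g) = G"
    "\<And>g T. upset n \<omega> d T \<Longrightarrow> card (lead_monoms n \<omega> (vspace n I d g) \<inter> T) \<le> card (G \<inter> T)"
proof -
  let ?c = "\<lambda>g T. card (lead_monoms n \<omega> (vspace n I d g) \<inter> T)"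
  let ?U = "{T. upset n \<omega> d T}"
  have finU: "finite ?U"
    by (rule finite_subset[of _ "Pow (monoms n d)"]) (auto simp: upset_def finite_monoms)
  have "\<exists>p. p \<in> polyring (n * n) \<and> p \<noteq> 0 \<and> (\<forall>g g'. mpeval n p g \<noteq> 0 \<longrightarrow> ?c g' T \<le> ?c g T)"
    if T: "upset n \<omega> d T" for T
  proof -
    have "\<forall>g. ?c g T \<le> card (monoms n d)"
      by (auto intro!: card_mono finite_monoms dest!: subsetD[OF lead_monoms_subset[OF vspace_forms]])
    then obtain g\<^sub>0 where g0: "\<And>g. ?c g T \<le> ?c g\<^sub>0 T"
      using ex_has_greatest_nat[of "\<lambda>_. True" undefined "\<lambda>g. ?c g T" "Suc (card (monoms n d))"]
      by (auto simp: less_Suc_eq_le)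
    obtain p where "p \<in> polyring (n * n)" "mpeval n p g\<^sub>0 \<noteq> 0"
      "\<And>g. mpeval n p g \<noteq> 0 \<Longrightarrow> ?c g\<^sub>0 T \<le> ?c g T"
      using rank_semicontinuous[OF I T] by blast
    then show ?thesis using g0 by (intro exI[of _ p]) (auto intro: order_trans)
  qed
  then obtain P where P: "\<And>T. T \<in> ?U \<Longrightarrow> P T \<in> polyring (n * n)" "\<And>T. T \<in> ?U \<Longrightarrow> P T \<noteq> 0"
    "\<And>T g g'. T \<in> ?U \<Longrightarrow> mpeval n (P T) g \<noteq> 0 \<Longrightarrow> ?c g' T \<le> ?c g T"
    by (metis (no_types, lifting) mem_Collect_eq)
  define p where "p = (\<Prod>T\<in>?U. P T)"
  have p: "p \<in> polyring (n * n)" "p \<noteq> 0"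
    using P(1,2) finU by (auto simp: p_def intro!: polyring_prod)
  have max: "?c g' T \<le> ?c g T" if "mpeval n p g \<noteq> 0" "upset n \<omega> d T" for g g' T
    using that P(3)[of T g g'] finU by (auto simp: p_def peval.prod)
  \<comment> \<open>A reference matrix whose leading monomials serve as \<open>G\<close>; it exists
    because the field is infinite.\<close>
  obtain g\<^sub>1 where g1: "mpeval n p g\<^sub>1 \<noteq> 0" using mpeval_nonzero[OF inf p] by blast
  show thesis
  proof (rule that[OF p])
    fix g assume g: "mpeval n p g \<noteq> 0"
    show "lead_monoms n \<omega> (vspace n I d g) = lead_monoms n \<omega> (vspace n I d g\<^sub>1)"
    proof (rule upset_card_inj[where n = n and d = d and \<omega> = \<omega>])
      fix T assume "upset n \<omega> d T"
      then show "?c g T = ?c g\<^sub>1 T" using max g g1 by (blast intro: antisym)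
    qed (rule lead_monoms_subset[OF vspace_forms])+
  next
    fix g T assume "upset n \<omega> d T"
    then show "?c g T \<le> ?c g\<^sub>1 T" using max g1 by blast
  qed
qed

subsection \<open>Weights and degenerations\<close>

definition wpart :: "nat \<Rightarrow> (nat \<Rightarrow> real) \<Rightarrow> real \<Rightarrow> 'k::comm_ring_1 mpoly \<Rightarrow> 'k mpoly" where
  "wpart n \<omega> u = restr {m. mweight n \<omega> m = u}"

definition weight_le :: "nat \<Rightarrow> (nat \<Rightarrow> real) \<Rightarrow> real \<Rightarrow> 'k::zero mpoly \<Rightarrow> bool" where
  "weight_le n \<omega> u f \<longleftrightarrow> (\<forall>m\<in>keys f. mweight n \<omega> m \<le> u)"

definition weight_gt :: "nat \<Rightarrow> (nat \<Rightarrow> real) \<Rightarrow> real \<Rightarrow> 'k::zero mpoly \<Rightarrow> bool" where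
  "weight_gt n \<omega> u f \<longleftrightarrow> (\<forall>m\<in>keys f. u < mweight n \<omega> m)"

text \<open>The weight-\<open>u\<close> part of the space of initial forms. An \<open>f\<close> of
  smaller weight contributes 0, so for a subspace \<open>V\<close> this is a subspace too, which a
  set of initial forms need not be.\<close>

definition wlayer :: "nat \<Rightarrow> (nat \<Rightarrow> real) \<Rightarrow> 'k::comm_ring_1 mpoly set \<Rightarrow> real \<Rightarrow> 'k mpoly set" where
  "wlayer n \<omega> V u = wpart n \<omega> u ` {f \<in> V. weight_le n \<omega> u f}"

lemma wpart_add: "wpart n \<omega> u (f + g) = wpart n \<omega> u f + wpart n \<omega> u g"
  by (simp add: wpart_def restr_add)

lemma wpart_diff: "wpart n \<omega> u (f - g) = wpart n \<omega> u f - wpart n \<omega> u g"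
  using wpart_add[of n \<omega> u "f - g" g] by (simp add: algebra_simps)

lemma wpart_scale: "wpart n \<omega> u (Const c * f) = Const c * wpart n \<omega> u f"
  by (simp add: wpart_def restr_scale)

lemma keys_wpart: "keys (wpart n \<omega> u f) = {m \<in> keys f. mweight n \<omega> m = u}"
  by (auto simp: wpart_def keys_restr)

lemma weight_le_diff: "weight_le n \<omega> u f \<Longrightarrow> weight_le n \<omega> u g \<Longrightarrow> weight_le n \<omega> u (f - g)"
  using keys_diff[of f g] unfolding weight_le_def by blast

lemma keys_mult_mweight:
  assumes "m \<in> keys (f * g)"
  obtains a b where "a \<in> keys f" "b \<in> keys g" "mweight n \<omega> m = mweight n \<omega> a + mweight n \<omega> b"
  using keys_mult[of f g] assms mweight_add by blast

lemma weight_le_mult: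
  "weight_le n \<omega> u f \<Longrightarrow> weight_le n \<omega> v g \<Longrightarrow> weight_le n \<omega> (u + v) (f * g)"
  unfolding weight_le_def by (metis keys_mult_mweight add_mono)

text \<open>Splitting off the top parts of both factors, every remaining product has weight strictly
  below \<open>u + v\<close>.\<close>

lemma wpart_mult:
  assumes "weight_le n \<omega> u f" "weight_le n \<omega> v g"
  shows "wpart n \<omega> (u + v) (f * g) = wpart n \<omega> u f * wpart n \<omega> v g"
proof -
  define f' where "f' = f - wpart n \<omega> u f"
  define g' where "g' = g - wpart n \<omega> v g"
  have lookup': "lookup (h - wpart n \<omega> w h) m = (if mweight n \<omega> m = w then 0 else lookup h m)"
    for h :: "'a mpoly" and w m
    by (simp add: lookup_minus wpart_def lookup_restr)
  have f': "mweight n \<omega> m < u" if "m \<in> keys f'" for m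
    using that assms(1) unfolding weight_le_def f'_def in_keys_iff lookup'
    by (simp add: less_le in_keys_iff split: if_splits)
  have g': "mweight n \<omega> m < v" if "m \<in> keys g'" for m
    using that assms(2) unfolding weight_le_def g'_def in_keys_iff lookup'
    by (simp add: less_le in_keys_iff split: if_splits)
  have top: "wpart n \<omega> (u + v) (wpart n \<omega> u f * wpart n \<omega> v g) = wpart n \<omega> u f * wpart n \<omega> v g"
    unfolding wpart_def[of n \<omega> "u + v"]
    by (rule restr_id) (auto elim!: keys_mult_mweight[of _ _ _ n \<omega>] simp: keys_wpart)
  have low1: "wpart n \<omega> (u + v) (wpart n \<omega> u f * g') = 0"
    unfolding wpart_def[of n \<omega> "u + v"]
    by (rule restr_disjoint)
      (auto elim!: keys_mult_mweight[of _ _ _ n \<omega>] simp: keys_wpart dest!: g')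
  have low2: "wpart n \<omega> (u + v) (f' * g) = 0"
    unfolding wpart_def[of n \<omega> "u + v"]
  proof (rule restr_disjoint, rule equals0I)
    fix m assume m: "m \<in> keys (f' * g) \<inter> {m. mweight n \<omega> m = u + v}"
    then obtain a b where "a \<in> keys f'" "b \<in> keys g" "mweight n \<omega> m = mweight n \<omega> a + mweight n \<omega> b"
      by (blast elim: keys_mult_mweight)
    then have "mweight n \<omega> m < u + v"
      using f'[of a] assms(2) unfolding weight_le_def by fastforce
    then show False using m by simp
  qed
  have "f * g = wpart n \<omega> u f * wpart n \<omega> v g + wpart n \<omega> u f * g' + f' * g"
    by (simp add: f'_def g'_def algebra_simps)
  then show ?thesis by (simp add: wpart_add top low1 low2)
qed

lemma weight_gt_sum: "(\<And>i. i \<in> S \<Longrightarrow> weight_gt n \<omega> u (f i)) \<Longrightarrow> weight_gt n \<omega> u (\<Sum>i\<in>S. f i)"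
  using keys_sum[of f S] unfolding weight_gt_def by blast

lemma weight_gt_add: "weight_gt n \<omega> u f \<Longrightarrow> weight_gt n \<omega> u g \<Longrightarrow> weight_gt n \<omega> u (f + g)"
  using keys_add[of f g] unfolding weight_gt_def by blast

lemma keys_Const_mult: "keys (Const c * f) \<subseteq> keys f"
  by (auto simp: in_keys_iff)

lemma weight_gt_scale: "weight_gt n \<omega> u f \<Longrightarrow> weight_gt n \<omega> u (Const c * f)"
  using keys_Const_mult unfolding weight_gt_def by blast

lemma weight_gt_mult:
  "weight_gt n \<omega> u f \<Longrightarrow> weight_gt n \<omega> v g \<Longrightarrow> weight_gt n \<omega> (u + v) (f * g)"
  unfolding weight_gt_def by (metis keys_mult_mweight add_strict_mono)

lemma weight_gt_single_mult:
  assumes "weight_gt n \<omega> u f"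
  shows "weight_gt n \<omega> (mweight n \<omega> a + u) (single a c * f)"
  unfolding weight_gt_def
proof
  fix m assume "m \<in> keys (single a c * f)"
  then obtain x y where xy: "x \<in> keys (single a c)" "y \<in> keys f"
    "mweight n \<omega> m = mweight n \<omega> x + mweight n \<omega> y" by (rule keys_mult_mweight)
  then have "x = a" by (auto split: if_splits)
  then show "mweight n \<omega> a + u < mweight n \<omega> m" using xy assms by (auto simp: weight_gt_def)
qed

section \<open>Unipotent substitutions raise weights\<close>

definition raises :: "nat \<Rightarrow> (nat \<Rightarrow> real) \<Rightarrow> (nat \<Rightarrow>\<^sub>0 nat) \<Rightarrow> 'k::comm_ring_1 mpoly \<Rightarrow> bool" where
  "raises n \<omega> a p \<longleftrightarrow> weight_gt n \<omega> (mweight n \<omega> a) (p - single a 1)"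

lemma raises_0: "raises n \<omega> 0 1"
  by (simp add: raises_def weight_gt_def)

text \<open>Multiplicativity is what allows the condition to be checked on the variables
  alone.\<close>

lemma raises_mult:
  assumes "raises n \<omega> a p" "raises n \<omega> b q"
  shows "raises n \<omega> (a + b) (p * q)"
proof -
  let ?p = "p - single a 1" and ?q = "q - single b 1"
  have "p * q - single (a + b) 1 = ?p * ?q + single a 1 * ?q + single b 1 * ?p"
    by (simp add: algebra_simps mult_single)
  moreover have "weight_gt n \<omega> (mweight n \<omega> a + mweight n \<omega> b) (?p * ?q)"
    using assms unfolding raises_def by (rule weight_gt_mult)
  moreover have "weight_gt n \<omega> (mweight n \<omega> a + mweight n \<omega> b) (single a 1 * ?q)"
    using assms unfolding raises_def by (intro weight_gt_single_mult)
  moreover have "weight_gt n \<omega> (mweight n \<omega> a + mweight n \<omega> b) (single b 1 * ?p)"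
    using assms unfolding raises_def add.commute[of "mweight n \<omega> a"] by (intro weight_gt_single_mult)
  ultimately show ?thesis unfolding raises_def mweight_add by (simp add: weight_gt_add)
qed

lemma raises_power: "raises n \<omega> (single j 1) p \<Longrightarrow> raises n \<omega> (single j k) (p ^ k)"
proof (induction k)
  case (Suc k)
  then have "raises n \<omega> (single j 1 + single j k) (p * p ^ k)" by (intro raises_mult)
  then show ?case by (simp flip: single_add)
qed (simp add: raises_0)

lemma raises_prod:
  "(\<And>i. i \<in> S \<Longrightarrow> raises n \<omega> (a i) (p i)) \<Longrightarrow> raises n \<omega> (\<Sum>i\<in>S. a i) (\<Prod>i\<in>S. p i)"
  by (induction S rule: infinite_finite_induct) (auto simp: raises_0 raises_mult)

lemma raises_mon:
  assumes "\<And>j. j \<in> keys a \<Longrightarrow> raises n \<omega> (single j 1) (\<sigma> j)"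
  shows "raises n \<omega> a (mon \<sigma> a)"
proof -
  have "raises n \<omega> (\<Sum>j\<in>keys a. single j (lookup a j)) (\<Prod>j\<in>keys a. \<sigma> j ^ lookup a j)"
    using assms by (intro raises_prod raises_power)
  then show ?thesis by (simp add: mon_def sum_single_lookup)
qed

lemma mweight_single: "i < n \<Longrightarrow> mweight n \<omega> (single i 1) = \<omega> i"
proof -
  assume "i < n"
  have "mweight n \<omega> (single i 1) = (\<Sum>j<n. if j = i then \<omega> i else 0)"
    unfolding mweight_def by (intro sum.cong) (auto simp: lookup_single when_def)
  then show ?thesis using \<open>i < n\<close> by simp
qed

text \<open>A matrix in \<open>Bw\<close> sends each variable to itself plus variables of strictly
  greater weight, hence each monomial to itself plus terms of greater weight.\<close>

lemma weight_gt_lsub_Bw: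
  fixes f :: "'k::field mpoly"
  assumes b: "b \<in> Bw n \<omega>" and \<omega>: "\<forall>i j. i \<le> j \<and> j < n \<longrightarrow> \<omega> j \<le> \<omega> i"
    and f: "f \<in> polyring n" "\<And>m. m \<in> keys f \<Longrightarrow> u \<le> mweight n \<omega> m"
  shows "weight_gt n \<omega> u (lsub n b f - f)"
proof -
  let ?\<sigma> = "\<lambda>j. \<Sum>i<n. Const (b i j) * Var i"
  have Var: "raises n \<omega> (single j 1) (?\<sigma> j)" if j: "j < n" for j
  proof -
    have "?\<sigma> j - single (single j 1) 1 = (\<Sum>i\<in>{..<n} - {j}. Const (b i j) * Var i)"
      using b j by (simp add: sum.remove[of "{..<n}" j] Bw_def Var_def)
    moreover have "weight_gt n \<omega> (\<omega> j) (Const (b i j) * Var i)" if i: "i \<in> {..<n} - {j}" for i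
    proof (cases "b i j = 0")
      case True
      then show ?thesis by (simp add: weight_gt_def)
    next
      case False
      \<comment> \<open>A nonzero off-diagonal entry has \<open>i < j\<close> and \<omega> i
        different from \<omega> j; since the weights are decreasing, the inequality is
        strict.\<close>
      then have "\<not> j < i" "\<not> (i \<noteq> j \<and> \<omega> i = \<omega> j)" using b i j by (auto simp: Bw_def)
      moreover from this have "\<omega> j \<le> \<omega> i" using \<omega> j by auto
      ultimately have "\<omega> j < \<omega> i" using i by auto
      then show ?thesis
        using i by (intro weight_gt_scale) (simp add: weight_gt_def Var_def mweight_single[of i n \<omega>, simplified])
    qed
    ultimately show ?thesis
      unfolding raises_def mweight_single[OF j] by (simp only: weight_gt_sum)
  qed
  have "lsub n b f = (\<Sum>m\<in>keys f. Const (lookup f m) * mon ?\<sigma> m)"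
    by (simp add: lsub_def subst.E_def)
  moreover have "f = (\<Sum>m\<in>keys f. Const (lookup f m) * single m 1)"
    by (simp add: Const_mult_single sum_single_lookup)
  ultimately have "lsub n b f - f = (\<Sum>m\<in>keys f. Const (lookup f m) * (mon ?\<sigma> m - single m 1))"
    by (simp add: right_diff_distrib sum_subtractf)
  moreover have "weight_gt n \<omega> u (Const (lookup f m) * (mon ?\<sigma> m - single m 1))" if m: "m \<in> keys f" for m
  proof (rule weight_gt_scale)
    have "raises n \<omega> m (mon ?\<sigma> m)"
      by (rule raises_mon, rule Var) (use m f(1) in \<open>auto simp: polyring_def\<close>)
    then show "weight_gt n \<omega> u (mon ?\<sigma> m - single m 1)"
      using f(2)[OF m] by (fastforce simp: raises_def weight_gt_def)
  qed
  ultimately show ?thesis by (simp only: weight_gt_sum)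
qed

text \<open>All new terms have weight above the minimal weight of \<open>f\<close>, so the terms of
  minimal weight survive.\<close>

lemma lsub_Bw_inj:
  fixes f :: "'k::field mpoly"
  assumes b: "b \<in> Bw n \<omega>" and \<omega>: "\<forall>i j. i \<le> j \<and> j < n \<longrightarrow> \<omega> j \<le> \<omega> i"
    and f: "f \<in> polyring n" "lsub n b f = 0"
  shows "f = 0"
proof (rule ccontr)
  assume "f \<noteq> 0"
  then have ne: "keys f \<noteq> {}" by (metis keys_eq_empty)
  let ?u = "Min (mweight n \<omega> ` keys f)"
  obtain m where m: "m \<in> keys f" "mweight n \<omega> m = ?u"
    using Min_in[of "mweight n \<omega> ` keys f"] ne by (metis (no_types, lifting) finite_imageI finite_keys imageE image_is_empty)
  have "weight_gt n \<omega> ?u (lsub n b f - f)"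
    by (rule weight_gt_lsub_Bw[OF b \<omega> f(1)]) simp
  then have "m \<notin> keys (- f)" using m f(2) by (auto simp: weight_gt_def)
  then show False using m by (simp add: in_keys_iff)
qed

section \<open>Degeneration by diagonal matrices\<close>

definition diag :: "nat \<Rightarrow> (nat \<Rightarrow> 'k::zero) \<Rightarrow> nat \<Rightarrow> nat \<Rightarrow> 'k" where
  "diag n t i j = (if i = j \<and> i < n then t i else 0)"

lemma lsub_diag:
  assumes "f \<in> polyring n"
  shows "lsub n (diag n t) f = (\<Sum>a\<in>keys f. single a (lookup f a * mon t a))"
proof -
  have "(\<Sum>i<n. Const (diag n t i j) * Var i) = Const (t j) * Var j" if "j < n" for j
  proof -
    have "(\<Sum>i<n. Const (diag n t i j) * Var i) = (\<Sum>i<n. if i = j then Const (t j) * Var j else 0)"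
      by (intro sum.cong) (auto simp: diag_def)
    then show ?thesis using that by simp
  qed
  then have "lsub n (diag n t) f = subst (\<lambda>j. Const (t j) * Var j) f"
    unfolding lsub_def using assms by (intro subst_cong_keys) (auto simp: polyring_def)
  moreover have "Const c ^ k = Const (c ^ k)" for c :: 'a and k
    by (induction k) (auto simp: Const_mult)
  moreover have "(\<Prod>i\<in>S. Const (c i)) = Const (\<Prod>i\<in>S. c i)" for c :: "nat \<Rightarrow> 'a" and S
    by (induction S rule: infinite_finite_induct) (auto simp: Const_mult)
  ultimately have "lsub n (diag n t) f = (\<Sum>a\<in>keys f. Const (lookup f a) * (Const (mon t a) * mon Var a))"
    by (simp add: subst.E_def mon_def power_mult_distrib prod.distrib)
  then show ?thesis by (simp add: mon_Var Const_mult_single)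
qed

text \<open>The part of \<open>F i\<close> of weight \<open>w i\<close> is the limit of rescalings of \<open>t \<cdot> F i\<close> as the diagonal matrix
  \<open>t\<close> tends to infinity in the direction of the weight, and independence is an open condition.\<close>

lemma indep_on_degeneration:
  fixes F :: "'i \<Rightarrow> 'k::field mpoly"
  assumes inf: "infinite (UNIV :: 'k set)" and S: "finite S"
    and F: "\<And>i. i \<in> S \<Longrightarrow> F i \<in> polyring n" "\<And>i. i \<in> S \<Longrightarrow> weight_le n \<omega> (w i) (F i)"
    and ind: "indep_on T S (\<lambda>i. lookup (lsub n b (wpart n \<omega> (w i) (F i))))"
  obtains t where "indep_on T S (\<lambda>i. lookup (lsub n b (lsub n (diag n t) (F i))))"
proof -
  \<comment> \<open>The parameter is the diagonal \<open>t\<close>, and the order of a polynomial in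
    \<open>t\<close> is a bound for its weight. Taking the weight-\<open>u\<close> part and
    evaluating at (1,...,1) respects products and differences, so it serves as leading
    coefficient.\<close>
  let ?Q = "\<lambda>(h :: (nat \<Rightarrow> 'k) \<Rightarrow> 'k) u c. \<exists>p\<in>polyring n. h = (\<lambda>t. peval t p) \<and> weight_le n \<omega> u p
      \<and> c = peval (\<lambda>_. 1) (wpart n \<omega> u p)"
  have "\<exists>p u c. ?Q p u c \<and> c \<noteq> 0 \<and>
      (\<forall>t. p t \<noteq> 0 \<longrightarrow> indep_on T S (\<lambda>i m. lookup (lsub n b (lsub n (diag n t) (F i))) m))"
  proof (rule indep_on_open[where Q = ?Q, OF _ _ _ S _ ind])
    show "?Q (\<lambda>_. 1) 0 1"
      by (intro bexI[of _ 1]) (auto simp: weight_le_def wpart_def restr_id mweight_def)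
  next
    fix h u c h' u' c' assume "?Q h u c" "?Q h' u' c'"
    then obtain p q where "p \<in> polyring n" "q \<in> polyring n" "h = (\<lambda>t. peval t p)" "h' = (\<lambda>t. peval t q)"
      "weight_le n \<omega> u p" "weight_le n \<omega> u' q"
      "c = peval (\<lambda>_. 1) (wpart n \<omega> u p)" "c' = peval (\<lambda>_. 1) (wpart n \<omega> u' q)" by blast
    then show "?Q (\<lambda>x. h x * h' x) (u + u') (c * c')"
      by (intro bexI[of _ "p * q"]) (simp_all add: peval.mult polyring_mult weight_le_mult wpart_mult)
  next
    fix h u c h' c' assume "?Q h u c" "?Q h' u c'"
    then obtain p q where "p \<in> polyring n" "q \<in> polyring n" "h = (\<lambda>t. peval t p)" "h' = (\<lambda>t. peval t q)"
      "weight_le n \<omega> u p" "weight_le n \<omega> u q"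
      "c = peval (\<lambda>_. 1) (wpart n \<omega> u p)" "c' = peval (\<lambda>_. 1) (wpart n \<omega> u q)" by blast
    then show "?Q (\<lambda>x. h x - h' x) u (c - c')"
      by (intro bexI[of _ "p - q"]) (simp_all add: peval.diff polyring_diff weight_le_diff wpart_diff)
  next
    fix i m assume i: "i \<in> S"
    let ?l = "\<lambda>a. lookup (lsub n b (single a 1)) m"
    \<comment> \<open>The term of \<open>F i\<close> at \<open>a\<close> is scaled by the monomial
      t^a, so the coefficient at \<open>m\<close> is a polynomial in \<open>t\<close> with support
      inside that of \<open>F i\<close>; the weight bound is inherited.\<close>
    define p where "p = (\<Sum>a\<in>keys (F i). single a (lookup (F i) a * ?l a))"
    have lookup_p: "lookup p a = lookup (F i) a * ?l a" for a
      by (auto simp: p_def lookup_sum lookup_single when_def in_keys_iff)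
    have sub: "keys p \<subseteq> keys (F i)" by (auto simp: in_keys_iff lookup_p)
    have single: "lookup (lsub n b (single a c)) m = c * ?l a" for a c
      using lsub_scale[of n b c "single a 1"] by (simp add: Const_mult_single)
    have "lookup (lsub n b (lsub n (diag n t) (F i))) m = peval t p" for t
    proof -
      have "lookup (lsub n b (lsub n (diag n t) (F i))) m
          = (\<Sum>a\<in>keys (F i). (lookup (F i) a * mon t a) * ?l a)"
        unfolding lsub_diag[OF F(1)[OF i]] lsub_sum lookup_sum by (intro sum.cong refl single)
      then show ?thesis by (simp add: p_def peval.sum peval.single ac_simps)
    qed
    moreover have "p \<in> polyring n" "weight_le n \<omega> (w i) p"
      using sub F i unfolding polyring_def weight_le_def by blast+
    moreover have "lookup (lsub n b (wpart n \<omega> (w i) (F i))) m = peval (\<lambda>_. 1) (wpart n \<omega> (w i) p)"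
    proof -
      let ?A = "{a \<in> keys (F i). mweight n \<omega> a = w i}"
      have one: "mon (\<lambda>_. 1) a = (1 :: 'k)" for a by (simp add: mon_def)
      have "wpart n \<omega> (w i) (F i) = (\<Sum>a\<in>?A. single a (lookup (F i) a))"
        by (simp add: wpart_def restr_def)
      then have "lookup (lsub n b (wpart n \<omega> (w i) (F i))) m = (\<Sum>a\<in>?A. lookup p a)"
        by (simp only: lsub_sum lookup_sum lookup_p) (intro sum.cong refl single)
      also have "\<dots> = (\<Sum>a\<in>?A. lookup (wpart n \<omega> (w i) p) a * mon (\<lambda>_. 1) a)"
        by (intro sum.cong) (auto simp: wpart_def lookup_restr one)
      also have "\<dots> = peval (\<lambda>_. 1) (wpart n \<omega> (w i) p)"
        by (rule peval.superset[symmetric]) (use sub in \<open>auto simp: keys_wpart\<close>)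
      finally show ?thesis .
    qed
    ultimately show "?Q (\<lambda>t. lookup (lsub n b (lsub n (diag n t) (F i))) m) (w i)
        (lookup (lsub n b (wpart n \<omega> (w i) (F i))) m)"
      by (intro bexI[of _ p]) auto
  qed
  then obtain p u where p: "p \<in> polyring n" "peval (\<lambda>_. 1) (wpart n \<omega> u p) \<noteq> 0"
    "\<And>t. peval t p \<noteq> 0 \<Longrightarrow> indep_on T S (\<lambda>i m. lookup (lsub n b (lsub n (diag n t) (F i))) m)"
    by auto
  \<comment> \<open>The nonvanishing leading coefficient only shows that \<open>p\<close> is not the
    zero polynomial. The point (1,...,1) itself may be a zero of \<open>p\<close>, so
    \<open>t\<close> is chosen anew.\<close>
  have "p \<noteq> 0" using p(2) by (auto simp: wpart_def)
  then obtain t where "peval t p \<noteq> 0" using peval_nonzero[OF inf p(1)] by blast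
  then show thesis using that p(3) by blast
qed

subsection \<open>Invariance in a fixed degree\<close>

text \<open>Sums only: scalars are absorbed by the layers, which are closed under them.\<close>

inductive_set addspan :: "'a::comm_monoid_add set \<Rightarrow> 'a set" for B where
  zero: "0 \<in> addspan B"
| add: "x \<in> B \<Longrightarrow> y \<in> addspan B \<Longrightarrow> x + y \<in> addspan B"

lemma addspan_base: "x \<in> B \<Longrightarrow> x \<in> addspan B"
  using addspan.add[OF _ addspan.zero] by fastforce

lemma addspan_add: "x \<in> addspan B \<Longrightarrow> y \<in> addspan B \<Longrightarrow> x + y \<in> addspan B"
  by (induction x rule: addspan.induct) (auto simp: add.assoc intro: addspan.add)

lemma addspan_sum: "(\<And>i. i \<in> S \<Longrightarrow> f i \<in> addspan B) \<Longrightarrow> (\<Sum>i\<in>S. f i) \<in> addspan B"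
  by (induction S rule: infinite_finite_induct) (auto intro: addspan_add addspan.zero)

lemma addspan_image:
  assumes "x \<in> addspan B" "f 0 = 0" "\<And>x y. f (x + y) = f x + f y"
    and "\<And>x. x \<in> B \<Longrightarrow> f x \<in> addspan C"
  shows "f x \<in> addspan C"
  using assms(1) by (induction x rule: addspan.induct) (auto simp: assms addspan.zero addspan_add)

lemma addspan_subset_image:
  assumes "x \<in> addspan B" "f 0 = 0" "\<And>x y. f (x + y) = f x + f y"
    and "\<And>x. x \<in> B \<Longrightarrow> x \<in> f ` addspan B"
  shows "x \<in> f ` addspan B"
  using assms(1)
proof (induction x rule: addspan.induct)
  case zero
  show ?case using assms(2) addspan.zero[of B] by (intro image_eqI[of _ _ 0]) auto
next
  case (add x y)
  then obtain z w where "x = f z" "z \<in> addspan B" "y = f w" "w \<in> addspan B"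
    using assms(4) by blast
  then show ?case using assms(3) addspan_add[of z B w] by (intro image_eqI[of _ _ "z + w"]) auto
qed

lemma wlayer_scale:
  assumes "lin_closed V" "x \<in> wlayer n \<omega> V u"
  shows "Const c * x \<in> wlayer n \<omega> V u"
proof -
  obtain f where f: "f \<in> V" "weight_le n \<omega> u f" "x = wpart n \<omega> u f"
    using assms(2) by (auto simp: wlayer_def)
  then have "weight_le n \<omega> u (Const c * f)" using keys_Const_mult unfolding weight_le_def by blast
  then show ?thesis
    unfolding wlayer_def f(3) wpart_scale[symmetric] using f(1) assms(1)
    by (auto simp: lin_closed_def)
qed

lemma is_lead_weight_le: "is_lead n \<omega> f m \<Longrightarrow> weight_le n \<omega> (mweight n \<omega> m) f"
  using mle_mweight by (auto simp: is_lead_def weight_le_def)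

lemma is_lead_wpart: "is_lead n \<omega> f m \<Longrightarrow> is_lead n \<omega> (wpart n \<omega> (mweight n \<omega> m) f) m"
  by (auto simp: is_lead_def keys_wpart)

lemma wpart_forms: "f \<in> forms n d \<Longrightarrow> wpart n \<omega> u f \<in> forms n d"
  by (auto simp: forms_def keys_wpart)

text \<open>Otherwise the projections to the weights above \<open>u\<close> of \<open>b x\<close> and of the images under \<open>b\<close> of
  the higher layers would be independent; degenerating would give a matrix of larger rank
  than \<open>g\<close>.\<close>

lemma wlayer_step:
  fixes I :: "'k::field mpoly set" and n d :: nat
  defines "V \<equiv> \<lambda>g. vspace n I d g"
  assumes inf: "infinite (UNIV :: 'k set)" and I: "lin_closed I"
    and b: "b \<in> Bw n \<omega>" and \<omega>: "\<forall>i j. i \<le> j \<and> j < n \<longrightarrow> \<omega> j \<le> \<omega> i"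
    and max: "\<And>g' T. upset n \<omega> d T \<Longrightarrow>
      card (lead_monoms n \<omega> (V g') \<inter> T) \<le> card (lead_monoms n \<omega> (V g) \<inter> T)"
    and x: "x \<in> wlayer n \<omega> (V g) u"
  obtains S c e where "finite S" "\<And>m. m \<in> S \<Longrightarrow> m \<in> monoms n d \<and> u < mweight n \<omega> m"
    "\<And>m. m \<in> S \<Longrightarrow> e m \<in> wlayer n \<omega> (V g) (mweight n \<omega> m)"
    "lsub n b x = x + lsub n b (\<Sum>m\<in>S. Const (c m) * e m)"
proof -
  define T where "T = {m \<in> monoms n d. u < mweight n \<omega> m}"
  have T: "upset n \<omega> d T" unfolding upset_def T_def using mle_mweight by fastforce
  define S where "S = lead_monoms n \<omega> (V g) \<inter> T"
  have finS: "finite S" unfolding S_def T_def using finite_monoms by simp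
  obtain f where f: "\<And>m. m \<in> S \<Longrightarrow> f m \<in> V g" "\<And>m. m \<in> S \<Longrightarrow> is_lead n \<omega> (f m) m"
  proof -
    have "\<forall>m\<in>S. \<exists>f. f \<in> V g \<and> is_lead n \<omega> f m" by (auto simp: S_def lead_monoms_def)
    then show thesis using that by metis
  qed
  obtain f\<^sub>0 where f0: "f\<^sub>0 \<in> V g" "weight_le n \<omega> u f\<^sub>0" "x = wpart n \<omega> u f\<^sub>0"
    using x by (auto simp: wlayer_def)
  \<comment> \<open>The index \<open>None\<close> stands for the representative of \<open>x\<close>,
    \<open>Some m\<close> for the element of \<open>V g\<close> leading in \<open>m\<close>.
    Independence of the whole family would give one more than \<open>card S\<close>.\<close>
  define F where "F i = (case i of None \<Rightarrow> f\<^sub>0 | Some m \<Rightarrow> f m)" for i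
  define w where "w i = (case i of None \<Rightarrow> u | Some m \<Rightarrow> mweight n \<omega> m)" for i
  define e where "e m = wpart n \<omega> (mweight n \<omega> m) (f m)" for m
  let ?S = "insert None (Some ` S)"
  have V: "V h \<subseteq> forms n d" for h unfolding V_def by (rule vspace_forms)
  have FV: "F i \<in> V g" if "i \<in> ?S" for i
    using that f f0 by (auto simp: F_def)
  have Fw: "weight_le n \<omega> (w i) (F i)" if "i \<in> ?S" for i
    using that f0 f(2)[THEN is_lead_weight_le] by (auto simp: F_def w_def)
  have e: "e m \<in> wlayer n \<omega> (V g) (mweight n \<omega> m)" if "m \<in> S" for m
    unfolding e_def wlayer_def
    by (intro imageI CollectI conjI f(1)[OF that] is_lead_weight_le f(2)[OF that])
  have e_lead: "is_lead n \<omega> (e m) m" if "m \<in> S" for m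
    using f[OF that] is_lead_wpart by (auto simp: e_def)
  have S_gt: "u < mweight n \<omega> m" "m \<in> monoms n d" if "m \<in> S" for m
    using that by (auto simp: S_def T_def)

  have "\<not> indep_on T ?S (\<lambda>i. lookup (lsub n b (wpart n \<omega> (w i) (F i))))"
  proof
    assume ind: "indep_on T ?S (\<lambda>i. lookup (lsub n b (wpart n \<omega> (w i) (F i))))"
    have fin: "finite ?S" using finS by simp
    have Fp: "F i \<in> polyring n" if "i \<in> ?S" for i using FV[OF that] V forms_polyring by blast
    obtain t where t: "indep_on T ?S (\<lambda>i. lookup (lsub n b (lsub n (diag n t) (F i))))"
      using indep_on_degeneration[OF inf fin Fp Fw ind] by blast
    \<comment> \<open>Some diagonal entry of \<open>t\<close> may be 0, so \<open>g'\<close> may be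
      singular; the hypothesis \<open>max\<close> covers this case.\<close>
    define g' where "g' = mmult n (mmult n b (diag n t)) g"
    have "lsub n b (lsub n (diag n t) (F i)) \<in> V g'" if "i \<in> ?S" for i
      using FV[OF that] unfolding V_def vspace_def g'_def by (auto simp: lsub_lsub)
    then have "card ?S \<le> card (lead_monoms n \<omega> (V g') \<inter> T)"
      unfolding V_def
      by (intro indep_card_lead_monoms[OF lin_closed_vspace[OF I] vspace_forms T fin _ t])
    also have "\<dots> \<le> card S" unfolding S_def using T by (rule max)
    finally show False using finS by (simp add: card_image)
  qed
  then obtain c where c0: "\<And>m. m \<in> T \<Longrightarrow>
      (\<Sum>i\<in>?S. c i * lookup (lsub n b (wpart n \<omega> (w i) (F i))) m) = 0" "\<exists>i\<in>?S. c i \<noteq> 0"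
    unfolding indep_on_def by blast
  have gt_T: "m \<in> T" if "h \<in> forms n d" "weight_gt n \<omega> u h" "m \<in> keys h" for h m
    using that unfolding T_def forms_def weight_gt_def by blast
  define y where "y = (\<lambda>c. \<Sum>m\<in>S. Const (c m) * e m)"
  have y_forms: "y c \<in> forms n d" for c
    unfolding y_def using f(1) V by (auto intro!: forms_sum forms_scale wpart_forms simp: e_def)
  have y_gt: "weight_gt n \<omega> u (y c)" for c
    unfolding y_def
    by (intro weight_gt_sum weight_gt_scale) (auto simp: e_def weight_gt_def keys_wpart S_gt)
  have by_gt: "weight_gt n \<omega> u (lsub n b (y c))" for c
  proof -
    have "weight_gt n \<omega> u (lsub n b (y c) - y c)"
      by (rule weight_gt_lsub_Bw[OF b \<omega>])
        (use y_forms forms_polyring y_gt in \<open>auto simp: weight_gt_def less_imp_le\<close>)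
    from weight_gt_add[OF this y_gt[of c]] show ?thesis by simp
  qed
  have c: "c None * lookup (lsub n b x) m + lookup (lsub n b (y (\<lambda>m. c (Some m)))) m = 0"
    if "m \<in> T" for m
    using c0(1)[OF that] finS
    by (simp add: sum.reindex F_def w_def e_def y_def f0(3) lsub_sum lsub_scale lookup_sum)
  have x_forms: "x \<in> forms n d" unfolding f0(3) using f0(1) V by (blast intro: wpart_forms)
  have bx_gt: "weight_gt n \<omega> u (lsub n b x - x)"
    using x_forms forms_polyring
    by (intro weight_gt_lsub_Bw[OF b \<omega>]) (auto simp: f0(3) keys_wpart)
  have x_T: "lookup x m = 0" if "m \<in> T" for m
    using that by (auto simp: f0(3) wpart_def lookup_restr T_def)
  \<comment> \<open>Otherwise the relation only involves the \<open>e m\<close>, and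
    \<open>b\<close> kills a nontrivial combination of elements with distinct leading monomials,
    against injectivity.\<close>
  have cN: "c None \<noteq> 0"
  proof
    assume cN: "c None = 0"
    let ?y = "y (\<lambda>m. c (Some m))"
    have "lsub n b ?y = 0"
    proof (rule poly_mapping_eqI)
      fix m
      show "lookup (lsub n b ?y) m = lookup 0 m"
      proof (cases "m \<in> T")
        case True
        then show ?thesis using c[OF True] cN by simp
      next
        case False
        then have "m \<notin> keys (lsub n b ?y)" using gt_T[OF lsub_forms[OF y_forms] by_gt] by blast
        then show ?thesis by (simp add: in_keys_iff)
      qed
    qed
    then have "?y = 0" by (rule lsub_Bw_inj[OF b \<omega> subsetD[OF forms_polyring y_forms]])
    moreover have "\<exists>m\<in>S. c (Some m) \<noteq> 0" using c0(2) cN by auto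
    ultimately show False
      using lookup_sum_lead[OF finS e_lead, of "\<lambda>m. c (Some m)"] unfolding y_def by auto
  qed
  define c' where "c' m = - c (Some m) / c None" for m
  have y_c': "y c' = Const (- 1 / c None) * y (\<lambda>m. c (Some m))"
    by (simp add: y_def c'_def sum_distrib_left mult.assoc[symmetric] Const_mult[symmetric])
  \<comment> \<open>Both sides are forms of weight above \<open>u\<close>, hence supported in
    \<open>T\<close>. There \<open>x\<close> itself has no terms, and the relation divided by
    \<open>c None\<close> gives the equality.\<close>
  have "lsub n b x - x = lsub n b (y c')"
  proof (rule poly_mapping_eqI)
    fix m
    show "lookup (lsub n b x - x) m = lookup (lsub n b (y c')) m"
    proof (cases "m \<in> T")
      case True
      then show ?thesis
        using c[OF True] cN x_T[OF True] unfolding y_c' lsub_scale lookup_minus lookup_Const_mult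
        by (simp add: field_simps add_eq_0_iff)
    next
      case False
      have "lsub n b x - x \<in> forms n d"
        using forms_add[OF lsub_forms[OF x_forms] forms_scale[OF x_forms, of "- 1"]]
        by (simp add: Const_def single_uminus)
      then have "m \<notin> keys (lsub n b x - x)" using gt_T[OF _ bx_gt] False by blast
      moreover have "m \<notin> keys (lsub n b (y c'))"
        using gt_T[OF lsub_forms[OF y_forms] by_gt] False by blast
      ultimately show ?thesis by (simp add: in_keys_iff)
    qed
  qed
  then have "lsub n b x = x + lsub n b (\<Sum>m\<in>S. Const (c' m) * e m)"
    by (simp add: y_def algebra_simps)
  then show thesis using that[OF finS _ e] S_gt by blast
qed

text \<open>\<open>B\<close> may be any set containing the layers of this degree, so that the union
  over all degrees can be inserted later.\<close>

lemma wlayer_invariant: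
  fixes I :: "'k::field mpoly set" and n d :: nat
  defines "V \<equiv> \<lambda>g. vspace n I d g"
  assumes inf: "infinite (UNIV :: 'k set)" and I: "lin_closed I"
    and b: "b \<in> Bw n \<omega>" and \<omega>: "\<forall>i j. i \<le> j \<and> j < n \<longrightarrow> \<omega> j \<le> \<omega> i"
    and max: "\<And>g' T. upset n \<omega> d T \<Longrightarrow>
      card (lead_monoms n \<omega> (V g') \<inter> T) \<le> card (lead_monoms n \<omega> (V g) \<inter> T)"
    and B: "\<And>u. wlayer n \<omega> (V g) u \<subseteq> B"
    and x: "x \<in> wlayer n \<omega> (V g) u"
  shows "lsub n b x \<in> addspan B" "x \<in> lsub n b ` addspan B"
proof -
  have step: "\<exists>S c e. finite S \<and> (\<forall>m\<in>S. m \<in> monoms n d \<and> u < mweight n \<omega> m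
      \<and> e m \<in> wlayer n \<omega> (V g) (mweight n \<omega> m))
      \<and> lsub n b x = x + lsub n b (\<Sum>m\<in>S. Const (c m) * e m)"
    if x: "x \<in> wlayer n \<omega> (V g) u" for x u
  proof (rule wlayer_step[OF inf I b \<omega>])
    show "card (lead_monoms n \<omega> (vspace n I d g') \<inter> T) \<le> card (lead_monoms n \<omega> (vspace n I d g) \<inter> T)"
      if "upset n \<omega> d T" for g' T
      using max[OF that] unfolding V_def .
    show "x \<in> wlayer n \<omega> (vspace n I d g) u" using x unfolding V_def .
  next
    fix S c e
    assume "finite S" "\<And>m. m \<in> S \<Longrightarrow> m \<in> monoms n d \<and> u < mweight n \<omega> m"
      "\<And>m. m \<in> S \<Longrightarrow> e m \<in> wlayer n \<omega> (vspace n I d g) (mweight n \<omega> m)"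
      "lsub n b x = x + lsub n b (\<Sum>m\<in>S. Const (c m) * e m)"
    then show ?thesis unfolding V_def by (intro exI[of _ S] exI[of _ c] exI[of _ e]) simp
  qed
  have lin: "lin_closed (V g)" unfolding V_def by (rule lin_closed_vspace[OF I])
  show "lsub n b x \<in> addspan B"
    using x
  \<comment> \<open>Real weights are not well-founded, so the descent counts the monomials of degree
    \<open>d\<close> above the current weight. The count drops when \<open>u\<close> is replaced by
    the weight of \<open>m\<close>, because \<open>m\<close> itself is lost.\<close>
  proof (induction "card {m \<in> monoms n d. u < mweight n \<omega> m}" arbitrary: x u rule: less_induct)
    case less
    obtain S c e where S: "finite S" "\<And>m. m \<in> S \<Longrightarrow> m \<in> monoms n d \<and> u < mweight n \<omega> m"
      "\<And>m. m \<in> S \<Longrightarrow> e m \<in> wlayer n \<omega> (V g) (mweight n \<omega> m)"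
      "lsub n b x = x + lsub n b (\<Sum>m\<in>S. Const (c m) * e m)"
      using step[OF less.prems] by (elim exE conjE) (rule that, auto)
    have "lsub n b (Const (c m) * e m) \<in> addspan B" if m: "m \<in> S" for m
    proof (rule less.hyps)
      show "Const (c m) * e m \<in> wlayer n \<omega> (V g) (mweight n \<omega> m)"
        using wlayer_scale[OF lin S(3)[OF m]] .
      show "card {a \<in> monoms n d. mweight n \<omega> m < mweight n \<omega> a} < card {a \<in> monoms n d. u < mweight n \<omega> a}"
        using S(2)[OF m] finite_monoms[of n d] by (intro psubset_card_mono) (auto intro: less_trans)
    qed
    then have "lsub n b (\<Sum>m\<in>S. Const (c m) * e m) \<in> addspan B"
      unfolding lsub_sum by (rule addspan_sum)
    moreover have "x \<in> addspan B" using B less.prems by (blast intro: addspan_base)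
    ultimately show ?case unfolding S(4) by (simp add: addspan_add)
  qed
  \<comment> \<open>For the other inclusion one step suffices: b x = x + b y rearranges to x = b (x
    - y), with no inverse of \<open>b\<close>.\<close>
  obtain S c e where S: "finite S" "\<And>m. m \<in> S \<Longrightarrow> m \<in> monoms n d \<and> u < mweight n \<omega> m"
    "\<And>m. m \<in> S \<Longrightarrow> e m \<in> wlayer n \<omega> (V g) (mweight n \<omega> m)"
    "lsub n b x = x + lsub n b (\<Sum>m\<in>S. Const (c m) * e m)"
    using step[OF x] by (elim exE conjE) (rule that, auto)
  have "(\<Sum>m\<in>S. Const (- c m) * e m) \<in> addspan B"
    using B wlayer_scale[OF lin S(3)] by (intro addspan_sum addspan_base) blast
  moreover have "x \<in> addspan B" using B x by (blast intro: addspan_base)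
  moreover have "(\<Sum>m\<in>S. Const (- c m) * e m) = - (\<Sum>m\<in>S. Const (c m) * e m)"
    by (simp add: Const_def single_uminus sum_negf)
  ultimately have "x - (\<Sum>m\<in>S. Const (c m) * e m) \<in> addspan B"
    using addspan_add by fastforce
  moreover have "x = lsub n b (x - (\<Sum>m\<in>S. Const (c m) * e m))"
    using S(4) by (simp add: lsub_diff)
  ultimately show "x \<in> lsub n b ` addspan B" by blast
qed

subsection \<open>Genericity in all degrees\<close>

text \<open>Every sequence has a monotone subsequence, and a decreasing one in the naturals is
  constant from its minimum on.\<close>

lemma nat_seq_mono_subseq:
  fixes s :: "nat \<Rightarrow> nat"
  obtains r :: "nat \<Rightarrow> nat" where "strict_mono r" "mono (\<lambda>k. s (r k))"
proof -
  obtain r :: "nat \<Rightarrow> nat" where r: "strict_mono r" "monoseq (\<lambda>k. s (r k))"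
    using seq_monosub[of s] by blast
  from r(2) consider "incseq (\<lambda>k. s (r k))" | "decseq (\<lambda>k. s (r k))"
    by (auto simp: monoseq_iff)
  then show thesis
  proof cases
    case 1
    then show thesis using that r(1) by blast
  next
    case 2
    obtain K where K: "\<And>k. s (r K) \<le> s (r k)"
      using ex_has_least_nat[of "\<lambda>_. True" 0 "\<lambda>k. s (r k)"] by auto
    have "s (r (K + k)) = s (r K)" for k
      using K[of "K + k"] decseqD[OF 2, of K "K + k"] by simp
    then have "mono (\<lambda>k. s (r (K + k)))" by (simp add: mono_def)
    moreover have "strict_mono (\<lambda>k. r (K + k))"
      using r(1) by (simp add: strict_mono_def)
    ultimately show thesis using that by blast
  qed
qed

lemma nat_seqs_mono_subseq:
  fixes s :: "nat \<Rightarrow> nat \<Rightarrow> nat"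
  shows "\<exists>r :: nat \<Rightarrow> nat. strict_mono r \<and> (\<forall>i<n. mono (\<lambda>k. s (r k) i))"
proof (induction n)
  case 0
  show ?case by (auto intro!: exI[of _ id] simp: strict_mono_def)
next
  case (Suc n)
  then obtain r :: "nat \<Rightarrow> nat" where r: "strict_mono r" "\<And>i. i < n \<Longrightarrow> mono (\<lambda>k. s (r k) i)" by blast
  obtain q :: "nat \<Rightarrow> nat" where q: "strict_mono q" "mono (\<lambda>k. s (r (q k)) n)"
    using nat_seq_mono_subseq[of "\<lambda>k. s (r k) n"] by blast
  have "mono (\<lambda>k. s (r (q k)) i)" if "i < Suc n" for i
  proof (cases "i = n")
    case False
    then have "mono (\<lambda>k. s (r k) i)" using r(2) that by simp
    then show ?thesis
      using strict_mono_leD[OF q(1)] unfolding mono_def by blast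
  qed (use q in simp)
  moreover have "strict_mono (\<lambda>k. r (q k))" using r(1) q(1) by (simp add: strict_mono_def)
  ultimately show ?case by blast
qed

lemma monomial_divides:
  assumes "keys a \<subseteq> {..<n}" "keys m \<subseteq> {..<n}" "\<And>i. i < n \<Longrightarrow> lookup a i \<le> lookup m i"
  obtains c where "keys c \<subseteq> {..<n}" "m = c + (a :: nat \<Rightarrow>\<^sub>0 nat)"
proof
  have le: "lookup a i \<le> lookup m i" for i
  proof (cases "i < n")
    case False
    then have "i \<notin> keys a" using assms(1) by auto
    then show ?thesis by (simp add: in_keys_iff)
  qed (use assms(3) in simp)
  have sub: "lookup (m - a) i = lookup m i - lookup a i" for i
    by transfer simp
  show "m = (m - a) + a"
    by (rule poly_mapping_eqI) (simp add: lookup_add sub le)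
  show "keys (m - a) \<subseteq> {..<n}"
    using assms(2) by (auto simp: in_keys_iff sub subset_iff)
qed

text \<open>\<open>F\<close> consists of the elements minimal for divisibility. An infinite
  \<open>F\<close> would contain a sequence of distinct elements; a subsequence increasing in every
  coordinate has its first term dividing its second, against minimality. Minimal divisors exist by
  induction on the degree.\<close>

lemma dickson:
  assumes M: "M \<subseteq> {m :: nat \<Rightarrow>\<^sub>0 nat. keys m \<subseteq> {..<n}}"
  obtains F where "finite F" "F \<subseteq> M" "\<And>m. m \<in> M \<Longrightarrow> \<exists>a\<in>F. \<exists>c. keys c \<subseteq> {..<n} \<and> m = c + a"
proof -
  define dv where "dv a m \<longleftrightarrow> (\<exists>c. keys c \<subseteq> {..<n} \<and> m = c + a)" for a m :: "nat \<Rightarrow>\<^sub>0 nat"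
  define F where "F = {m \<in> M. \<forall>a\<in>M. dv a m \<longrightarrow> a = m}"
  have "finite F"
  proof (rule ccontr)
    assume "infinite F"
    then obtain s :: "nat \<Rightarrow> nat \<Rightarrow>\<^sub>0 nat" where s: "inj s" "range s \<subseteq> F"
      using infinite_countable_subset by blast
    obtain r :: "nat \<Rightarrow> nat" where r: "strict_mono r" "\<And>i. i < n \<Longrightarrow> mono (\<lambda>k. lookup (s (r k)) i)"
      using nat_seqs_mono_subseq[of n "\<lambda>k. lookup (s k)"] by auto
    have F: "s (r 0) \<in> F" "s (r 1) \<in> F" using s(2) by auto
    then have keys: "keys (s (r 0)) \<subseteq> {..<n}" "keys (s (r 1)) \<subseteq> {..<n}"
      using M by (auto simp: F_def)
    have "lookup (s (r 0)) i \<le> lookup (s (r 1)) i" if "i < n" for i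
      using monoD[OF r(2)[OF that], of 0 1] by simp
    then have "dv (s (r 0)) (s (r 1))"
      using monomial_divides[OF keys] unfolding dv_def by blast
    then have "s (r 0) = s (r 1)" using F by (auto simp: F_def)
    then have "r 0 = r 1" using s(1) by (simp add: inj_eq)
    then show False using strict_monoD[OF r(1), of 0 1] by simp
  qed
  moreover have "F \<subseteq> M" by (auto simp: F_def)
  moreover have "\<exists>a\<in>F. dv a m" if "m \<in> M" for m
    using that
  proof (induction "mdeg m" arbitrary: m rule: less_induct)
    case less
    show ?case
    proof (cases "m \<in> F")
      case True
      then show ?thesis by (intro bexI[of _ m]) (auto simp: dv_def intro!: exI[of _ 0])
    next
      case False
      then obtain a where a: "a \<in> M" "dv a m" "a \<noteq> m" using less.prems by (auto simp: F_def)
      then obtain c where c: "keys c \<subseteq> {..<n}" "m = c + a" by (auto simp: dv_def)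
      then have "c \<noteq> 0" using a by auto
      then obtain i where "i \<in> keys c" by (metis all_not_in_conv keys_eq_empty)
      then have "mdeg c \<noteq> 0" by (auto simp: mdeg_def in_keys_iff) 
      then have "mdeg a < mdeg m" by (simp add: c(2) mdeg_add)
      then obtain a' where a': "a' \<in> F" "dv a' a" using less.hyps a(1) by blast
      then obtain c' where "keys c' \<subseteq> {..<n}" "a = c' + a'" by (auto simp: dv_def)
      then have "dv a' m" unfolding dv_def c(2) using c(1)
        by (intro exI[of _ "c + c'"]) (simp add: keys_subset_add add.assoc)
      then show ?thesis using a' by blast
    qed
  qed
  ultimately show thesis using that by (auto simp: dv_def)
qed

section \<open>Invertible matrices and the determinant as a polynomial\<close>

lemma mdet_det: "mdet n h = det (mat n n (\<lambda>(i, j). h i j))"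
  unfolding mdet_def det_def
  by (auto simp: atLeast0LessThan permutes_in_image intro!: sum.cong prod.cong arg_cong2[of _ _ _ _ "(*)"])

lemma GL_right_inverse:
  assumes "g \<in> GL n"
  obtains g' where "\<forall>i<n. \<forall>j<n. mmult n g g' i j = (if i = j then 1 else 0)"
proof -
  let ?A = "mat n n (\<lambda>(i, j). g i j)"
  have A: "?A \<in> carrier_mat n n" by simp
  have det: "det ?A \<noteq> 0" using assms by (simp add: GL_def mdet_det)
  define B where "B = (1 / det ?A) \<cdot>\<^sub>m adj_mat ?A"
  have B: "B \<in> carrier_mat n n" using adj_mat(1)[OF A] by (simp add: B_def)
  have "?A * B = (1 / det ?A) \<cdot>\<^sub>m (?A * adj_mat ?A)"
    unfolding B_def by (rule mult_smult_distrib[OF A adj_mat(1)[OF A]])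
  also have "\<dots> = 1\<^sub>m n" unfolding adj_mat(2)[OF A] using det by (intro eq_matI) auto
  finally have AB: "?A * B = 1\<^sub>m n" .
  show thesis
  proof (rule that, intro allI impI)
    fix i j assume ij: "i < n" "j < n"
    have "(?A * B) $$ (i, j) = (\<Sum>k<n. g i k * B $$ (k, j))"
      using ij B by (simp add: scalar_prod_def atLeast0LessThan)
    then show "mmult n g (\<lambda>i j. B $$ (i, j)) i j = (if i = j then 1 else 0)"
      using ij by (simp add: AB mmult_def)
  qed
qed

text \<open>The Leibniz formula read in the variables of the matrix entries; it is nonzero because
  its value at the identity matrix is 1.\<close>

lemma det_polynomial:
  obtains p :: "'k::field mpoly" where "p \<in> polyring (n * n)" "p \<noteq> 0" "\<And>h. mpeval n p h = mdet n h"
proof -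
  define p :: "'k mpoly" where
    "p = (\<Sum>\<pi> | \<pi> permutes {..<n}. Const (of_int (sign \<pi>)) * (\<Prod>i<n. Var (i * n + \<pi> i)))"
  have p: "p \<in> polyring (n * n)"
    unfolding p_def
    by (intro polyring_sum polyring_mult polyring_prod polyring_Const Var_entry_polyring)
      (auto dest: permutes_in_image)
  have ev: "mpeval n p h = mdet n h" for h
    unfolding p_def mdet_def peval.sum peval.mult peval.prod peval.Const
    by (intro sum.cong prod.cong arg_cong2[of _ _ _ _ "(*)"] refl mpeval_Var)
      (auto dest: permutes_in_image)
  have "mat n n (\<lambda>(i, j). if i = j then 1 else 0) = (1\<^sub>m n :: 'k mat)"
    by (intro eq_matI) auto
  then have "mdet n (\<lambda>i j. if i = j then 1 else 0 :: 'k) = 1" by (simp add: mdet_det)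
  then have "p \<noteq> 0" using ev[of "\<lambda>i j. if i = j then 1 else 0"] by auto
  then show thesis using that p ev by blast
qed

lemma lsub_surj:
  assumes g: "\<forall>i<n. \<forall>j<n. mmult n g g' i j = (if i = j then 1 else 0)"
    and f: "f \<in> polyring n"
  shows "lsub n g (lsub n g' f) = f"
proof -
  have "(\<Sum>i<n. Const (mmult n g g' i j) * Var i) = Var j" if "j < n" for j
  proof -
    have "(\<Sum>i<n. Const (mmult n g g' i j) * Var i) = (\<Sum>i<n. if i = j then Var i else 0)"
      using g that by (intro sum.cong) auto
    then show ?thesis using that by simp
  qed
  then have "lsub n (mmult n g g') f = subst Var f"
    unfolding lsub_def using f by (intro subst_cong_keys) (auto simp: polyring_def)
  then show ?thesis by (simp add: lsub_lsub subst_Var)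
qed

lemma lookup_single_mult_add:
  fixes f :: "'k::comm_ring_1 mpoly"
  shows "lookup (single a c * f) (a + m) = c * lookup f m"
proof -
  have "single a c * f = (\<Sum>b\<in>keys f. single (a + b) (c * lookup f b))"
    using arg_cong[OF sum_single_lookup[OF finite_keys order_refl, of f, symmetric], of "(*) (single a c)"]
    by (simp add: sum_distrib_left mult_single)
  then show ?thesis
    by (auto simp: lookup_sum lookup_single when_def in_keys_iff)
qed

lemma keys_single_mult_subset: "keys (single a c * f) \<subseteq> (+) a ` keys f"
  using keys_mult[of "single a c" f] by (auto split: if_splits)

lemma is_lead_single_mult:
  assumes "is_lead n \<omega> f m"
  shows "is_lead n \<omega> (single a (1 :: 'k::comm_ring_1) * f) (a + m)"
  unfolding is_lead_def
proof
  show "a + m \<in> keys (single a 1 * f)"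
    using assms by (simp add: in_keys_iff lookup_single_mult_add is_lead_def)
  show "\<forall>l\<in>keys (single a 1 * f). mle n \<omega> l (a + m)"
    using assms keys_single_mult_subset[of a 1 f] mle_add[of n \<omega> _ m a]
    by (fastforce simp: is_lead_def add.commute)
qed

lemma is_ideal_lin_closed: "is_ideal n I \<Longrightarrow> lin_closed I"
  by (auto simp: is_ideal_def lin_closed_def)

text \<open>A term is the image under \<open>g\<close> of its own image under the right inverse, so
  multiplication by it can be pulled back to \<open>I\<close>.\<close>

lemma vspace_single_mult:
  assumes I: "is_ideal n I"
    and g: "\<forall>i<n. \<forall>j<n. mmult n g g' i j = (if i = j then 1 else 0)"
    and a: "keys a \<subseteq> {..<n}" and f: "f \<in> vspace n I d g"
  shows "single a c * f \<in> vspace n I (mdeg a + d) g"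
proof -
  obtain f' where f': "f' \<in> I" "f' \<in> forms n d" "f = lsub n g f'" using f by (auto simp: vspace_def)
  have s: "single a c \<in> forms n (mdeg a)" using a by (intro forms_single) (simp add: monoms_def)
  then have sp: "single a c \<in> polyring n" using forms_polyring by blast
  let ?s = "lsub n g' (single a c)"
  have "?s \<in> polyring n" by (rule lsub_polyring)
  then have "?s * f' \<in> I" using I f'(1) by (simp add: is_ideal_def)
  moreover have "?s * f' \<in> forms n (mdeg a + d)" using s f'(2) by (intro forms_mult lsub_forms)
  moreover have "lsub n g (?s * f') = single a c * f"
    using lsub_surj[OF g sp] by (simp add: lsub_mult f'(3))
  ultimately show ?thesis unfolding vspace_def by (metis IntI imageI)
qed

lemma lead_monoms_vspace_add:
  assumes "is_ideal n I"
    and "\<forall>i<n. \<forall>j<n. mmult n g g' i j = (if i = j then 1 else 0)"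
    and "keys a \<subseteq> {..<n}" "m \<in> lead_monoms n \<omega> (vspace n I d g)"
  shows "a + m \<in> lead_monoms n \<omega> (vspace n I (mdeg a + d) g)"
  using assms(4) vspace_single_mult[OF assms(1-3), of _ d 1] is_lead_single_mult
  unfolding lead_monoms_def by blast

section \<open>The initial ideal as a sum of layers\<close>

lemma sum_hcomp: "(\<Sum>d\<in>mdeg ` keys f. hcomp d f) = f"
proof (rule poly_mapping_eqI)
  fix m
  have "lookup (\<Sum>d\<in>mdeg ` keys f. hcomp d f) m = (\<Sum>d\<in>mdeg ` keys f. if d = mdeg m then lookup f m else 0)"
    unfolding lookup_sum hcomp_restr lookup_restr by (intro sum.cong) auto
  also have "\<dots> = lookup f m"
    by (auto simp: in_keys_iff)
  finally show "lookup (\<Sum>d\<in>mdeg ` keys f. hcomp d f) m = lookup f m" .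
qed

lemma hcomp_lsub:
  assumes "f \<in> polyring n"
  shows "hcomp d (lsub n g f) = lsub n g (hcomp d f)"
proof -
  have "hcomp d (lsub n g f) = hcomp d (\<Sum>e\<in>mdeg ` keys f. lsub n g (hcomp e f))"
    by (simp add: sum_hcomp flip: lsub_sum)
  also have "\<dots> = (\<Sum>e\<in>mdeg ` keys f. if e = d then lsub n g (hcomp e f) else 0)"
    unfolding hcomp_restr[of d] restr_sum unfolding hcomp_restr[of d, symmetric]
    using hcomp_eq[OF lsub_forms[OF hcomp_forms[OF assms]]] by (intro sum.cong) auto
  also have "\<dots> = lsub n g (hcomp d f)"
  proof (cases "d \<in> mdeg ` keys f")
    case False
    then have "hcomp d f = 0" unfolding hcomp_restr by (intro restr_disjoint) auto
    then show ?thesis using False by simp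
  qed simp
  finally show ?thesis .
qed

lemma is_ideal_ideal_gen:
  assumes "S \<subseteq> polyring n"
  shows "is_ideal n (ideal_gen n S)" "S \<subseteq> ideal_gen n S"
proof -
  have "is_ideal n (polyring n)" by (simp add: is_ideal_def polyring_add polyring_mult)
  then have "ideal_gen n S \<subseteq> polyring n" using assms unfolding ideal_gen_def by blast
  then show "is_ideal n (ideal_gen n S)"
    by (auto simp: ideal_gen_def is_ideal_def)
  show "S \<subseteq> ideal_gen n S" by (auto simp: ideal_gen_def)
qed

lemma wlayer_single_mult:
  assumes I: "is_ideal n I"
    and g: "\<forall>i<n. \<forall>j<n. mmult n g g' i j = (if i = j then 1 else 0)"
    and a: "keys a \<subseteq> {..<n}" and x: "x \<in> wlayer n \<omega> (vspace n I d g) u"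
  shows "single a c * x \<in> wlayer n \<omega> (vspace n I (mdeg a + d) g) (mweight n \<omega> a + u)"
proof -
  obtain f where f: "f \<in> vspace n I d g" "weight_le n \<omega> u f" "x = wpart n \<omega> u f"
    using x by (auto simp: wlayer_def)
  have s: "weight_le n \<omega> (mweight n \<omega> a) (single a c)" by (simp add: weight_le_def)
  have "wpart n \<omega> (mweight n \<omega> a) (single a c) = single a c"
    by (auto simp: wpart_def intro!: restr_id split: if_splits)
  then have "single a c * x = wpart n \<omega> (mweight n \<omega> a + u) (single a c * f)"
    using wpart_mult[OF s f(2)] f(3) by simp
  then show ?thesis
    using vspace_single_mult[OF I g a f(1)] weight_le_mult[OF s f(2)] by (auto simp: wlayer_def)
qed

text \<open>Multiplication by a term maps layers into layers, so their sums form an ideal. It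
  contains every initial form, split into degrees by homogeneity of \<open>I\<close>, and conversely
  each nonzero layer element is an initial form.\<close>

lemma init_ideal_layers:
  fixes I :: "'k::field mpoly set"
  assumes I: "homogeneous_ideal n I"
    and g: "\<forall>i<n. \<forall>j<n. mmult n g g' i j = (if i = j then 1 else 0)"
  shows "init_ideal n \<omega> (act n g I) = addspan (\<Union>d u. wlayer n \<omega> (vspace n I d g) u)" (is "_ = addspan ?B")
proof -
  have I': "is_ideal n I" and hc: "\<And>f d. f \<in> I \<Longrightarrow> hcomp d f \<in> I"
    using I by (auto simp: homogeneous_ideal_def)
  have Ip: "I \<subseteq> polyring n" using I' by (simp add: is_ideal_def)
  have init_poly: "init_form n \<omega> ` act n g I \<subseteq> polyring n"
  proof (rule image_subsetI)
    fix f assume "f \<in> act n g I"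
    then have "f \<in> polyring n" by (auto simp: act_lsub lsub_polyring)
    then show "init_form n \<omega> f \<in> polyring n"
      by (auto simp: polyring_def init_form_restr keys_restr)
  qed
  note gen = is_ideal_ideal_gen[OF init_poly]
  show ?thesis
  proof
    have "is_ideal n (addspan ?B)"
      unfolding is_ideal_def
    proof (intro conjI ballI)
      show "addspan ?B \<subseteq> polyring n"
      proof
        fix x assume "x \<in> addspan ?B"
        then show "x \<in> polyring n"
        proof (induction x rule: addspan.induct)
          case (add x y)
          then obtain d u h where "h \<in> vspace n I d g" "x = wpart n \<omega> u h"
            by (auto simp: wlayer_def)
          then have "x \<in> forms n d" using vspace_forms wpart_forms by blast
          then show ?case using add.IH forms_polyring by (blast intro: polyring_add)
        qed simp
      qed
      show "0 \<in> addspan ?B" by (rule addspan.zero)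
      show "x + y \<in> addspan ?B" if "x \<in> addspan ?B" "y \<in> addspan ?B" for x y
        using that by (rule addspan_add)
      fix p x :: "'k mpoly" assume p: "p \<in> polyring n" and x: "x \<in> addspan ?B"
      have "single a c * x \<in> addspan ?B" if a: "keys a \<subseteq> {..<n}" for a c
      proof (rule addspan_image[OF x, of "(*) (single a c)"])
        fix x assume "x \<in> ?B"
        then obtain d u where "x \<in> wlayer n \<omega> (vspace n I d g) u" by blast
        from wlayer_single_mult[OF I' g a this] show "single a c * x \<in> addspan ?B"
          by (intro addspan_base) blast
      qed (auto simp: distrib_left)
      then have "(\<Sum>a\<in>keys p. single a (lookup p a) * x) \<in> addspan ?B"
        using p by (intro addspan_sum) (auto simp: polyring_def)
      then show "p * x \<in> addspan ?B"
        by (simp only: sum_distrib_right[symmetric] sum_single_lookup[OF finite_keys order_refl])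
    qed
    moreover have "init_form n \<omega> f \<in> addspan ?B" if "f \<in> act n g I" for f
    proof -
      from that obtain f' where f': "f' \<in> I" "f = lsub n g f'" by (auto simp: act_lsub)
      \<comment> \<open>One weight serves all degrees: a homogeneous component of smaller top weight
        contributes 0, which is in the layer. For \<open>f = 0\<close> the value of
        \<open>Max\<close> is unspecified, but the sum over degrees is empty.\<close>
      define u where "u = Max (mweight n \<omega> ` keys f)"
      have "init_form n \<omega> f = wpart n \<omega> u (\<Sum>d\<in>mdeg ` keys f. hcomp d f)"
        by (simp add: init_form_restr wpart_def u_def sum_hcomp)
      also have "\<dots> = (\<Sum>d\<in>mdeg ` keys f. wpart n \<omega> u (hcomp d f))"
        by (simp add: wpart_def restr_sum)
      also have "\<dots> \<in> addspan ?B"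
      proof (intro addspan_sum addspan_base)
        fix d assume "d \<in> mdeg ` keys f"
        have "hcomp d f = lsub n g (hcomp d f')" using f' Ip by (auto simp: hcomp_lsub)
        then have "hcomp d f \<in> vspace n I d g"
          using hc[OF f'(1)] hcomp_forms[of f' n d] f'(1) Ip unfolding vspace_def by blast
        moreover have "weight_le n \<omega> u (hcomp d f)"
          by (auto simp: weight_le_def u_def hcomp_restr keys_restr)
        ultimately show "wpart n \<omega> u (hcomp d f) \<in> ?B" by (auto simp: wlayer_def)
      qed
      finally show ?thesis .
    qed
    ultimately show "init_ideal n \<omega> (act n g I) \<subseteq> addspan ?B"
      unfolding init_ideal_def ideal_gen_def by blast
  next
    have base: "x \<in> init_ideal n \<omega> (act n g I)" if "x \<in> ?B" for x
    proof -
      obtain d u f where f: "f \<in> vspace n I d g" "weight_le n \<omega> u f" "x = wpart n \<omega> u f"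
        using \<open>x \<in> ?B\<close> by (auto simp: wlayer_def)
      show ?thesis
      \<comment> \<open>A layer element is the initial form of its representative only if weight
        \<open>u\<close> actually occurs there, which is the case when \<open>x\<close> is
        nonzero.\<close>
      proof (cases "x = 0")
        case True
        then show ?thesis using gen(1) by (simp add: init_ideal_def is_ideal_def)
      next
        case False
        then obtain m where "m \<in> keys f" "mweight n \<omega> m = u"
          unfolding f(3) by (metis (mono_tags, lifting) all_not_in_conv keys_eq_empty keys_wpart mem_Collect_eq)
        then have "Max (mweight n \<omega> ` keys f) = u"
          using f(2) by (intro Max_eqI) (auto simp: weight_le_def)
        then have "x = init_form n \<omega> f" by (simp add: f(3) init_form_restr wpart_def)
        moreover have "f \<in> act n g I" using f(1) by (auto simp: vspace_def act_lsub)
        ultimately show ?thesis using gen(2) by (auto simp: init_ideal_def)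
      qed
    qed
    show "addspan ?B \<subseteq> init_ideal n \<omega> (act n g I)"
    proof
      fix x assume "x \<in> addspan ?B"
      then show "x \<in> init_ideal n \<omega> (act n g I)"
      proof (induction x rule: addspan.induct)
        case zero
        then show ?case using gen(1) by (simp add: init_ideal_def is_ideal_def)
      next
        case (add x y)
        then show ?case using gen(1) base by (simp add: init_ideal_def is_ideal_def)
      qed
    qed
  qed
qed

text \<open>Galligo's argument: by Dickson's lemma the generic leading monomials of all degrees are multiples of
  finitely many of them, so genericity in finitely many degrees yields it in all degrees.\<close>

lemma generic_matrix:
  fixes I :: "'k::field mpoly set"
  assumes inf: "infinite (UNIV :: 'k set)" and I: "is_ideal n I"
  obtains p where "p \<in> polyring (n * n)" "p \<noteq> 0" "\<And>g. mpeval n p g \<noteq> 0 \<Longrightarrow> mdet n g \<noteq> 0"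
    "\<And>g g' d T. g \<in> matrices n \<Longrightarrow> mpeval n p g \<noteq> 0 \<Longrightarrow> upset n \<omega> d T \<Longrightarrow>
      card (lead_monoms n \<omega> (vspace n I d g') \<inter> T) \<le> card (lead_monoms n \<omega> (vspace n I d g) \<inter> T)"
proof -
  have lin: "lin_closed I" using I by (rule is_ideal_lin_closed)
  let ?LM = "\<lambda>d g. lead_monoms n \<omega> (vspace n I d g)"
  have "\<exists>p G. p \<in> polyring (n * n) \<and> p \<noteq> 0 \<and> (\<forall>g. mpeval n p g \<noteq> 0 \<longrightarrow> ?LM d g = G) \<and>
      (\<forall>g T. upset n \<omega> d T \<longrightarrow> card (?LM d g \<inter> T) \<le> card (G \<inter> T))" for d
    using generic_lead_monoms[OF inf lin, of n \<omega> d] by metis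
  then obtain P G where PG: "\<And>d. P d \<in> polyring (n * n)" "\<And>d. P d \<noteq> 0"
    "\<And>d g. mpeval n (P d) g \<noteq> 0 \<Longrightarrow> ?LM d g = G d"
    "\<And>d g T. upset n \<omega> d T \<Longrightarrow> card (?LM d g \<inter> T) \<le> card (G d \<inter> T)"
    by metis
  have G: "G d \<subseteq> monoms n d" for d
    using mpeval_nonzero[OF inf PG(1,2)] PG(3) lead_monoms_subset[OF vspace_forms] by metis
  have "(\<Union>d. G d) \<subseteq> {m. keys m \<subseteq> {..<n}}" using G unfolding monoms_def by blast
  then obtain F where F: "finite F" "F \<subseteq> (\<Union>d. G d)"
    "\<And>m. m \<in> (\<Union>d. G d) \<Longrightarrow> \<exists>a\<in>F. \<exists>c. keys c \<subseteq> {..<n} \<and> m = c + a"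
    using dickson by metis
  obtain \<Delta> where \<Delta>: "\<Delta> \<in> polyring (n * n)" "\<Delta> \<noteq> 0" "\<And>h :: nat \<Rightarrow> nat \<Rightarrow> 'k. mpeval n \<Delta> h = mdet n h"
    using det_polynomial by blast
  \<comment> \<open>The determinant ensures invertibility; the other factors ensure genericity in
    the degrees of the finitely many Dickson generators.\<close>
  define p where "p = \<Delta> * (\<Prod>d\<in>mdeg ` F. P d)"
  have max: "card (?LM d g' \<inter> T) \<le> card (?LM d g \<inter> T)"
    if g: "g \<in> matrices n" "mpeval n p g \<noteq> 0" and T: "upset n \<omega> d T" for g g' d T
  proof -
    have P: "mpeval n (P e) g \<noteq> 0" if "e \<in> mdeg ` F" for e
      using g(2) that F(1) by (auto simp: p_def peval.mult peval.prod)
    have "g \<in> GL n" using g by (auto simp: GL_def p_def peval.mult \<Delta>(3))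
    then obtain h where h: "\<forall>i<n. \<forall>j<n. mmult n g h i j = (if i = j then 1 else 0)"
      using GL_right_inverse by blast
    \<comment> \<open>One inclusion is enough, as the counts of \<open>G d\<close> bound those of
      every matrix. In degrees without a factor in \<open>p\<close> it comes from multiplying
      generators.\<close>
    have "G d \<subseteq> ?LM d g"
    proof
      fix m assume m: "m \<in> G d"
      then obtain a c where ac: "a \<in> F" "keys c \<subseteq> {..<n}" "m = c + a" using F(3) by blast
      then obtain e where "a \<in> G e" using F(2) by blast
      \<comment> \<open>All elements of \<open>G e\<close> have degree \<open>e\<close>, so the
        degree in which a generator is generic can be read off from it.\<close>
      then have e: "a \<in> G (mdeg a)" using G by (auto simp: monoms_def)
      then have "a \<in> ?LM (mdeg a) g" using PG(3)[OF P] ac(1) by simp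
      then have "c + a \<in> ?LM (mdeg c + mdeg a) g" by (rule lead_monoms_vspace_add[OF I h ac(2)])
      moreover have "mdeg c + mdeg a = d" using subsetD[OF G m] ac(3) by (simp add: monoms_def mdeg_add)
      ultimately show "m \<in> ?LM d g" using ac(3) by simp
    qed
    then have "card (G d \<inter> T) \<le> card (?LM d g \<inter> T)"
      using finite_subset[OF lead_monoms_subset[OF vspace_forms] finite_monoms]
      by (intro card_mono finite_Int disjI1) auto
    then show ?thesis using PG(4)[OF T, of g'] by (rule order_trans[rotated])
  qed
  show thesis
  proof (rule that[OF _ _ _ max])
    show "p \<in> polyring (n * n)"
      unfolding p_def by (intro polyring_mult polyring_prod \<Delta> PG)
    show "p \<noteq> 0" using \<Delta> PG F(1) by (simp add: p_def)
    show "mdet n g \<noteq> 0" if "mpeval n p g \<noteq> 0" for g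
      using that by (auto simp: p_def peval.mult \<Delta>(3))
  qed
qed

theorem theorem3p2:
  fixes n :: nat and I :: "'k::field mpoly set" and \<omega> :: "nat \<Rightarrow> real"
  assumes "infinite (UNIV :: 'k set)"
    and "homogeneous_ideal n I"
    and "\<forall>i j. i \<le> j \<and> j < n \<longrightarrow> \<omega> j \<le> \<omega> i"
  shows "\<exists>U. zariski_open n U \<and> U \<noteq> {} \<and> U \<subseteq> GL n \<and>
    (\<forall>g\<in>U. \<forall>b\<in>Bw n \<omega>. act n b (init_ideal n \<omega> (act n g I)) = init_ideal n \<omega> (act n g I))"
proof -
  have I: "is_ideal n I" using assms(2) by (simp add: homogeneous_ideal_def)
  obtain p where p: "p \<in> polyring (n * n)" "p \<noteq> 0" "\<And>g. mpeval n p g \<noteq> 0 \<Longrightarrow> mdet n g \<noteq> 0"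
    "\<And>g g' d T. g \<in> matrices n \<Longrightarrow> mpeval n p g \<noteq> 0 \<Longrightarrow> upset n \<omega> d T \<Longrightarrow>
      card (lead_monoms n \<omega> (vspace n I d g') \<inter> T) \<le> card (lead_monoms n \<omega> (vspace n I d g) \<inter> T)"
    using generic_matrix[OF assms(1) I, where \<omega> = \<omega>] by blast
  define U where "U = {g \<in> matrices n. mpeval n p g \<noteq> 0}"
  have "zariski_open n U"
    unfolding zariski_open_def U_def using p(1) by (intro exI[of _ "{p}"]) auto
  moreover have "U \<noteq> {}" using mpeval_nonzero[OF assms(1) p(1,2)] by (auto simp: U_def)
  moreover have GL: "U \<subseteq> GL n" using p(3) by (auto simp: U_def GL_def)
  moreover have "act n b (init_ideal n \<omega> (act n g I)) = init_ideal n \<omega> (act n g I)"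
    if g: "g \<in> U" and b: "b \<in> Bw n \<omega>" for g b
  proof -
    \<comment> \<open>Invertibility of \<open>g\<close> is what turns the initial ideal into sums of
      layers, each of which lies in a single degree.\<close>
    obtain g' where "\<forall>i<n. \<forall>j<n. mmult n g g' i j = (if i = j then 1 else 0)"
      using GL_right_inverse g GL by blast
    then have init: "init_ideal n \<omega> (act n g I) = addspan (\<Union>d u. wlayer n \<omega> (vspace n I d g) u)"
      (is "_ = addspan ?B") by (rule init_ideal_layers[OF assms(2)])
    have inv: "lsub n b x \<in> addspan ?B" "x \<in> lsub n b ` addspan ?B" if x: "x \<in> ?B" for x
    proof -
      obtain d u where x: "x \<in> wlayer n \<omega> (vspace n I d g) u" using x by blast
      have max: "card (lead_monoms n \<omega> (vspace n I d g') \<inter> T) \<le> card (lead_monoms n \<omega> (vspace n I d g) \<inter> T)"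
        if "upset n \<omega> d T" for g' T
        using p(4)[OF _ _ that] g by (simp add: U_def)
      have B: "wlayer n \<omega> (vspace n I d g) u \<subseteq> ?B" for u by blast
      show "lsub n b x \<in> addspan ?B" "x \<in> lsub n b ` addspan ?B"
        by (rule wlayer_invariant[OF assms(1) is_ideal_lin_closed[OF I] b assms(3) _ B x], erule max)+
    qed
    show ?thesis
      unfolding act_lsub[of n b] init
      using addspan_image[where f = "lsub n b", OF _ lsub_0 lsub_add inv(1)]
        addspan_subset_image[where f = "lsub n b", OF _ lsub_0 lsub_add inv(2)]
      by blast
  qed
  ultimately show ?thesis by blast
qed

end
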